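(* There exists a semigroup $(P_t)_{t\ge0}$ on $\mathcal{L}$ such that $P_tf(\eta)=E^\eta[f(\eta_t)]$ for all $f\in\mathcal{L}$ and all finite configurations $\eta$, where $E^\eta$ is the expectation for the countable-state zero-range Markov chain started from $\eta$. Moreover, for all $\eta,\zeta\in\Omega'$, $f\in\mathcal{L}$ and $t\ge0$, the semigroup satisfies $$|P_tf(\eta)-P_tf(\zeta)|\le c(f)\,e^{4a_0t}\,\|\eta-\zeta\|,$$ and $c(P_tf)\le c(f)e^{4a_0t}$. Also, $$P_tf(\eta)=f(\eta)+\int_0^tLP_sf(\eta)\,ds .$$
   Context: $\mathbb{N}_0=\{0,1,2,\ldots\}$. The rate $g:\mathbb{N}_0\to[0,\infty)$ satisfies $g(0)=0$, $g(k)>0$ for $k\ge1$, and $\sup_{k\ge0}|g(k+1)-g(k)|\le a_0<\infty$. $p$ is an irreducible transition probability on $\mathbb{Z}^d$ (not necessarily translation-invariant or finite-range) with $\lim_{x\to\infty}p(x,y)=0$ for every $y\in\mathbb{Z}^d$; $p^{(n)}$ denotes the $n$-step transition probability. Set $\beta(x)=\sum_{n\ge0}2^{-n}p^{(n)}(x,0)$. For $\eta,\zeta\in\Omega=\mathbb{N}_0^{\mathbb{Z}^d}$ put $\|\eta-\zeta\|=\sum_x|\eta(x)-\zeta(x)|\beta(x)$, $\|\eta\|=\sum_x\eta(x)\beta(x)$, and $\Omega'=\{\eta\in\Omega:\|\eta\|<\infty\}$. A configuration is finite if $\sum_x\eta(x)<\infty$. $\mathcal{L}$ is the set of functions $f:\Omega'\to\mathbb{R}$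 for which there is a constant $c$ with $|f(\eta)-f(\zeta)|\le c\|\eta-\zeta\|$ for all $\eta,\zeta\in\Omega'$; $c(f)$ is the smallest such $c$. For $f\in\mathcal{L}$, $\eta\in\Omega'$, $$(Lf)(\eta)=\sum_{x,y\in\mathbb{Z}^d}p(x,x+y)g(\eta(x))\big[f(\eta^{x,x+y})-f(\eta)\big]$$ (an absolutely convergent sum), where $\eta^{x,z}$ is $\eta$ with one particle moved from $x$ to $z$. On the countable set of finite configurations $L$ is the generator of a (regular) continuous time Markov chain $\eta_t$, the countable-state zero-range process. A semigroup on $\mathcal{L}$ is a family of linear maps $P_t:\mathcal{L}\to\mathcal{L}$ with $P_0=I$ and $P_{t+s}=P_tP_s$ for $s,t\geq 0$. *)

theory Defs
  imports "HOL-Probability.Probability"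
begin

section \<open>Countable-state Markov chains in continuous time\<close>

text \<open>Right-continuous paths (for the discrete topology) with finitely many jumps in bounded
  time intervals; this excludes explosion.\<close>

definition step_path :: "(real \<Rightarrow> 's) \<Rightarrow> bool" where
  "step_path w \<longleftrightarrow>
     (\<forall>t\<ge>0. \<exists>e>0. \<forall>s\<in>{t..<t + e}. w s = w t) \<and>
     (\<forall>T\<ge>0. finite {t \<in> {0<..T}. \<not> (\<exists>e>0. \<forall>s\<in>{t - e<..<t}. w s = w t)})"

text \<open>\<open>Pr x\<close> is the law of the process started from \<open>x\<close>.\<close>

definition trans_prob :: "('s \<Rightarrow> 'w measure) \<Rightarrow> (real \<Rightarrow> 'w \<Rightarrow> 's) \<Rightarrow> real \<Rightarrow> 's \<Rightarrow> 's \<Rightarrow> real" where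
  "trans_prob Pr X t x y = measure (Pr x) {\<omega> \<in> space (Pr x). X t \<omega> = y}"

definition history :: "'s set \<Rightarrow> 'w measure \<Rightarrow> (real \<Rightarrow> 'w \<Rightarrow> 's) \<Rightarrow> real \<Rightarrow> 'w set set" where
  "history S M X s =
     sigma_sets (space M) {{\<omega> \<in> space M. X u \<omega> = y} | u y. 0 \<le> u \<and> u \<le> s \<and> y \<in> S}"

text \<open>The last clause is the Markov property
  \<open>P\<^sup>x(X(s+t) = z | history up to s) = P\<^sup>X\<^sup>(\<^sup>s\<^sup>)(X(t) = z)\<close>, with the conditional probability written
  out, which is possible because the state space is countable.\<close>

definition markov_chain :: "'s set \<Rightarrow> ('s \<Rightarrow> 'w measure) \<Rightarrow> (real \<Rightarrow> 'w \<Rightarrow> 's) \<Rightarrow> bool" where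
  "markov_chain S Pr X \<longleftrightarrow>
     countable S \<and>
     (\<forall>x\<in>S.
        prob_space (Pr x) \<and>
        (\<forall>t\<ge>0. X t \<in> measurable (Pr x) (count_space S)) \<and>
        (AE \<omega> in Pr x. X 0 \<omega> = x) \<and>
        (AE \<omega> in Pr x. step_path (\<lambda>t. X t \<omega>)) \<and>
        (\<forall>s\<ge>0. \<forall>t\<ge>0. \<forall>A\<in>history S (Pr x) X s. \<forall>y\<in>S. \<forall>z\<in>S.
           measure (Pr x) {\<omega> \<in> A. X s \<omega> = y \<and> X (s + t) \<omega> = z} =
           measure (Pr x) {\<omega> \<in> A. X s \<omega> = y} * trans_prob Pr X t y z))"

text \<open>An operator \<open>G\<close> on functions is the generator of the chain if its matrix
  \<open>q(x, y) = (G 1\<^bsub>{y}\<^esub>)(x)\<close> is the Q-matrix of the chain, i.e. the (right) derivative at time 0 of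
  the transition function.\<close>

definition has_generator ::
  "'s set \<Rightarrow> ('s \<Rightarrow> 'w measure) \<Rightarrow> (real \<Rightarrow> 'w \<Rightarrow> 's) \<Rightarrow> (('s \<Rightarrow> real) \<Rightarrow> 's \<Rightarrow> real) \<Rightarrow> bool" where
  "has_generator S Pr X G \<longleftrightarrow>
     (\<forall>x\<in>S. \<forall>y\<in>S.
        ((\<lambda>t. trans_prob Pr X t x y) has_real_derivative G (indicator {y}) x) (at 0 within {0..}))"


section \<open>The zero-range process\<close>

type_synonym 'd site = "int ^ 'd"
type_synonym 'd config = "'d site \<Rightarrow> nat"

text \<open>A transition probability \<open>p\<close> on \<open>\<int>\<^sup>d\<close> is a map to probability mass functions:
  \<open>p(x, y) = pmf (p x) y\<close>.\<close>

primrec nstep :: "('s \<Rightarrow> 's pmf) \<Rightarrow> nat \<Rightarrow> 's \<Rightarrow> 's pmf" where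
  "nstep p 0 x = return_pmf x"
| "nstep p (Suc n) x = bind_pmf (nstep p n x) p"

definition irreducible_kernel :: "('s \<Rightarrow> 's pmf) \<Rightarrow> bool" where
  "irreducible_kernel p \<longleftrightarrow> (\<forall>x y. \<exists>n. pmf (nstep p n x) y > 0)"

definition beta :: "('d::finite site \<Rightarrow> 'd site pmf) \<Rightarrow> 'd site \<Rightarrow> real" where
  "beta p x = (\<Sum>n. (1 / 2) ^ n * pmf (nstep p n x) 0)"

definition Omega' :: "('d::finite site \<Rightarrow> 'd site pmf) \<Rightarrow> 'd config set" where
  "Omega' p = {\<eta>. (\<lambda>x. real (\<eta> x) * beta p x) summable_on UNIV}"

definition finite_configs :: "'d::finite config set" where
  "finite_configs = {\<eta>. (\<lambda>x. real (\<eta> x)) summable_on UNIV}"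

text \<open>\<open>cdist p \<eta> \<zeta>\<close> is \<open>\<parallel>\<eta> - \<zeta>\<parallel>\<close>; it is only meant for \<open>\<eta>\<close>, \<open>\<zeta>\<close> in \<open>\<Omega>'\<close>, where the sum is finite.\<close>

definition cdist :: "('d::finite site \<Rightarrow> 'd site pmf) \<Rightarrow> 'd config \<Rightarrow> 'd config \<Rightarrow> real" where
  "cdist p \<eta> \<zeta> = (\<Sum>\<^sub>\<infinity>x. \<bar>real (\<eta> x) - real (\<zeta> x)\<bar> * beta p x)"

definition lipschitz_bound ::
  "('d::finite site \<Rightarrow> 'd site pmf) \<Rightarrow> ('d config \<Rightarrow> real) \<Rightarrow> real \<Rightarrow> bool" where
  "lipschitz_bound p f c \<longleftrightarrow>
     (\<forall>\<eta>\<in>Omega' p. \<forall>\<zeta>\<in>Omega' p. \<bar>f \<eta> - f \<zeta>\<bar> \<le> c * cdist p \<eta> \<zeta>)"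

text \<open>Real functions on \<open>\<Omega>'\<close> are represented by extensional functions, so that equality of elements
  of \<open>Lip p\<close> is equality on \<open>\<Omega>'\<close>.\<close>

definition Lip :: "('d::finite site \<Rightarrow> 'd site pmf) \<Rightarrow> ('d config \<Rightarrow> real) set" where
  "Lip p = {f \<in> extensional (Omega' p). \<exists>c. lipschitz_bound p f c}"

definition lip_const :: "('d::finite site \<Rightarrow> 'd site pmf) \<Rightarrow> ('d config \<Rightarrow> real) \<Rightarrow> real" where
  "lip_const p f = (LEAST c. lipschitz_bound p f c)"

text \<open>Only used with a positive number of particles at \<open>x\<close>: in the generator the rate
  \<open>g (\<eta> x)\<close> vanishes otherwise. For \<open>z = x\<close> nothing changes.\<close>

definition move :: "'d::finite config \<Rightarrow> 'd site \<Rightarrow> 'd site \<Rightarrow> 'd config" where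
  "move \<eta> x z = (let \<xi> = \<eta>(x := \<eta> x - 1) in \<xi>(z := \<xi> z + 1))"

definition zr_gen ::
  "('d::finite site \<Rightarrow> 'd site pmf) \<Rightarrow> (nat \<Rightarrow> real) \<Rightarrow> ('d config \<Rightarrow> real) \<Rightarrow> 'd config \<Rightarrow> real" where
  "zr_gen p g f \<eta> =
     (\<Sum>\<^sub>\<infinity>(x, y)\<in>UNIV. pmf (p x) (x + y) * g (\<eta> x) * (f (move \<eta> x (x + y)) - f \<eta>))"

definition zero_range_chain ::
  "('d::finite site \<Rightarrow> 'd site pmf) \<Rightarrow> (nat \<Rightarrow> real) \<Rightarrow>
   ('d config \<Rightarrow> 'w measure) \<Rightarrow> (real \<Rightarrow> 'w \<Rightarrow> 'd config) \<Rightarrow> bool" where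
  "zero_range_chain p g Pr X \<longleftrightarrow>
     markov_chain finite_configs Pr X \<and> has_generator finite_configs Pr X (zr_gen p g)"

definition semigroup_on_Lip ::
  "('d::finite site \<Rightarrow> 'd site pmf) \<Rightarrow>
   (real \<Rightarrow> ('d config \<Rightarrow> real) \<Rightarrow> ('d config \<Rightarrow> real)) \<Rightarrow> bool" where
  "semigroup_on_Lip p P \<longleftrightarrow>
     (\<forall>t\<ge>0. P t \<in> Lip p \<rightarrow> Lip p) \<and>
     (\<forall>t\<ge>0. \<forall>f\<in>Lip p. \<forall>h\<in>Lip p. \<forall>a b.
        P t (\<lambda>\<eta>\<in>Omega' p. a * f \<eta> + b * h \<eta>) =
        (\<lambda>\<eta>\<in>Omega' p. a * P t f \<eta> + b * P t h \<eta>)) \<and>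
     (\<forall>f\<in>Lip p. P 0 f = f) \<and>
     (\<forall>s\<ge>0. \<forall>t\<ge>0. \<forall>f\<in>Lip p. P (t + s) f = P t (P s f))"

end

theory Submission
  imports Defs
begin

text \<open>
  On configurations with \<open>N\<close> particles the generator \<open>L\<close> is bounded, so \<open>exp(t L)\<close> is given by its
  power series and yields the only solution, bounded on each such sector, of the backward equation.
  Hence it also equals \<open>exp(- l t) exp(t (L + l))\<close> for every \<open>l\<close>. Writing
  \<open>F\<^sub>u f(\<eta>) = f(\<eta> + \<delta>\<^sub>u) - f(\<eta>)\<close>, one has
  \<open>F\<^sub>u L f(\<eta>) = L F\<^sub>u f(\<eta>) + (g(\<eta>(u) + 1) - g(\<eta>(u))) \<Sum>\<^sub>y p(u, y) (F\<^sub>y f(\<eta>) - F\<^sub>u f(\<eta>))\<close>,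
  and \<open>\<Sum>\<^sub>y p(u, y) \<beta>(y) \<le> 2 \<beta>(u)\<close>. So for \<open>l \<ge> a\<^sub>0 N\<close> the operator \<open>L + l\<close> multiplies a Lipschitz
  constant by at most \<open>l + 3 a\<^sub>0\<close>, and \<open>exp(t L)\<close> by at most \<open>exp(3 a\<^sub>0 t)\<close>. This replaces a
  coupling of two processes, and lets \<open>exp(t L) f\<close> extend from finite configurations to \<open>\<Omega>'\<close>.

  A Markov chain with generator \<open>L\<close> satisfies the backward equation for bounded functions, so
  uniqueness identifies its transition function with \<open>exp(t L)\<close>. Applied to the indicator of a
  sector, this shows that the chain never leaves the sector it starts in, and Lipschitz functions
  are bounded there.
\<close>

section \<open>The weight \<open>\<beta>\<close> and finite configurations\<close>

text \<open>The norm of \<open>L\<close> on a sector grows with the number N of particles, so a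
  termwise estimate of the series of exp(tL) would give Lipschitz constants growing like exp((2 a0 N
  + 3 a0) t), useless for passing to infinite configurations. Adding l makes all weights nonnegative
  with total l instead of summing absolute values, and the factor exp(-lt) then cancels exactly the
  part depending on N. Since l must grow with N while the semigroup has to be one object,
  independence of l is indispensable; that is the first use of uniqueness. The 3 is 2 + 1: an extra
  particle jumping from u to y costs 2 \<beta>(u) on average, and it is compared with one staying at
  u, of cost \<beta>(u).

  For the chain, the difficulty is that a Q-matrix controls only entrywise right derivatives at 0,
  while the backward equation for a bounded function involves infinitely many states at once.
  Conservation of probability supplies the missing uniformity.\<close>

lemma integrable_pmf_bounded:
  fixes f :: "'a \<Rightarrow> real"
  assumes "\<And>y. y \<in> set_pmf M \<Longrightarrow> \<bar>f y\<bar> \<le> B"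
  shows "integrable (measure_pmf M) f"
  using assms by (intro measure_pmf.integrable_const_bound[where B = B]) (auto intro: AE_pmfI)

lemma abs_expectation_pmf_le:
  fixes f :: "'a \<Rightarrow> real"
  assumes "\<And>y. y \<in> set_pmf M \<Longrightarrow> \<bar>f y\<bar> \<le> B"
  shows "\<bar>measure_pmf.expectation M f\<bar> \<le> B"
proof -
  have "\<bar>measure_pmf.expectation M f\<bar> \<le> measure_pmf.expectation M (\<lambda>y. \<bar>f y\<bar>)"
    by (rule integral_abs_bound)
  also have "\<dots> \<le> measure_pmf.expectation M (\<lambda>_. B)"
    using assms by (intro integral_mono_AE integrable_abs integrable_pmf_bounded[of M f B])
      (auto intro: AE_pmfI)
  finally show ?thesis by simp
qed

text \<open>The definition appends steps at the end; averaging \<open>beta\<close> over one jump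
  needs the first step split off instead.\<close>

lemma nstep_Suc_left: "nstep p (Suc n) x = bind_pmf (p x) (nstep p n)"
proof (induction n)
  case 0
  show ?case by (simp add: bind_return_pmf bind_return_pmf')
next
  case (Suc n)
  have "nstep p (Suc (Suc n)) x = bind_pmf (nstep p (Suc n) x) p" by simp
  also have "\<dots> = bind_pmf (p x) (\<lambda>y. bind_pmf (nstep p n y) p)"
    by (simp only: Suc.IH bind_assoc_pmf)
  finally show ?case by simp
qed

lemma summable_beta: "summable (\<lambda>n. (1 / 2) ^ n * pmf (nstep p n x) y)"
  by (rule summable_comparison_test'[where g = "\<lambda>n. (1 / 2) ^ n" and N = 0])
    (auto simp: abs_mult pmf_le_1 intro!: mult_left_le)

lemma beta_nonneg: "0 \<le> beta p x"
  unfolding beta_def by (intro suminf_nonneg summable_beta) auto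

lemma beta_le_2: "beta p x \<le> 2"
proof -
  have "beta p x \<le> (\<Sum>n. (1 / 2) ^ n)"
    unfolding beta_def by (intro suminf_le summable_beta) (auto simp: pmf_le_1 intro!: mult_left_le)
  thus ?thesis by (simp add: suminf_geometric)
qed

text \<open>The term \<open>n = 0\<close> alone is 1. Positivity of the weight at the origin later
  forces Lipschitz constants to be nonnegative.\<close>

lemma beta_0_ge_1: "1 \<le> beta p 0"
proof -
  have "(\<Sum>n\<in>{0}. (1 / 2) ^ n * pmf (nstep p n 0) 0) \<le> beta p 0"
    unfolding beta_def by (intro sum_le_suminf summable_beta) auto
  thus ?thesis by simp
qed

lemma integrable_beta: "integrable (measure_pmf M) (beta p)"
  by (rule integrable_pmf_bounded[where B = 2]) (simp add: beta_nonneg beta_le_2)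

text \<open>Shifting the summation index in the definition of \<open>\<beta>\<close> costs a factor \<open>2\<close>.\<close>

lemma expectation_beta_le: "measure_pmf.expectation (p x) (beta p) \<le> 2 * beta p x"
proof -
  let ?f = "\<lambda>n y. (1 / 2 :: real) ^ n * pmf (nstep p n y) 0"
  have int: "integrable (measure_pmf (p x)) (?f n)" for n
    by (rule integrable_pmf_bounded[where B = 1])
      (auto simp: abs_mult pmf_le_1 intro!: mult_le_one power_le_one)
  have E: "measure_pmf.expectation (p x) (?f n) = (1 / 2) ^ n * pmf (nstep p (Suc n) x) 0" for n
    by (simp only: nstep_Suc_left pmf_bind integral_mult_right_zero)
  have Enorm: "measure_pmf.expectation (p x) (\<lambda>y. norm (?f n y)) =
      (1 / 2) ^ n * pmf (nstep p (Suc n) x) 0" for n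
    using E[of n] by simp
  have summ2: "summable (\<lambda>n. (1 / 2) ^ n * pmf (nstep p (Suc n) x) 0)"
    by (rule summable_comparison_test'[where g = "\<lambda>n. (1 / 2) ^ n" and N = 0])
      (auto simp: abs_mult pmf_le_1 simp del: nstep.simps intro!: mult_left_le)
  have "measure_pmf.expectation (p x) (beta p) = (\<Sum>n. measure_pmf.expectation (p x) (?f n))"
    unfolding beta_def[abs_def]
  proof (rule integral_suminf[OF int])
    show "AE y in measure_pmf (p x). summable (\<lambda>n. norm (?f n y))"
      using summable_beta by (intro AE_pmfI) simp
    show "summable (\<lambda>n. measure_pmf.expectation (p x) (\<lambda>y. norm (?f n y)))"
      unfolding Enorm by (rule summ2)
  qed
  also have "\<dots> = (\<Sum>n. (1 / 2) ^ n * pmf (nstep p (Suc n) x) 0)"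
    unfolding E ..
  also have "\<dots> = 2 * (\<Sum>n. (1 / 2) ^ Suc n * pmf (nstep p (Suc n) x) 0)"
    using suminf_mult[OF summ2, of "1 / 2"] by (simp add: mult.assoc del: nstep.simps)
  also have "(\<Sum>n. (1 / 2) ^ Suc n * pmf (nstep p (Suc n) x) 0) \<le> beta p x"
    unfolding beta_def by (subst suminf_split_head[OF summable_beta]) simp
  finally show ?thesis by simp
qed

section \<open>Sectors of fixed particle number and single-particle moves\<close>

definition support :: "('a \<Rightarrow> nat) \<Rightarrow> 'a set" where
  "support \<eta> = {x. \<eta> x \<noteq> 0}"

definition sector :: "nat \<Rightarrow> ('a \<Rightarrow> nat) set" where
  "sector N = {\<eta>. finite (support \<eta>) \<and> sum \<eta> (support \<eta>) = N}"

definition add_particle :: "('a \<Rightarrow> nat) \<Rightarrow> 'a \<Rightarrow> 'a \<Rightarrow> nat" where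
  "add_particle \<eta> u = \<eta>(u := \<eta> u + 1)"

text \<open>A summable family of natural numbers has only finitely many nonzero terms.\<close>

lemma finite_configs_eq: "finite_configs = {\<eta>. finite (support \<eta>)}"
  unfolding finite_configs_def support_def
  by (simp add: summable_on_of_nat_iff summable_on_discrete_iff)

lemma finite_configs_eq_sector: "finite_configs = (\<Union>N. sector N)"
  unfolding finite_configs_eq sector_def by auto

lemma sector_finite_configs: "\<eta> \<in> sector N \<Longrightarrow> \<eta> \<in> finite_configs"
  unfolding finite_configs_eq_sector by auto

lemma sum_sector:
  assumes "\<eta> \<in> sector N" "finite F" "support \<eta> \<subseteq> F"
  shows "sum \<eta> F = N"
proof -
  have "sum \<eta> F = sum \<eta> (support \<eta>)"
    using assms(2,3) by (intro sum.mono_neutral_right) (auto simp: support_def)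
  thus ?thesis using assms(1) by (simp add: sector_def)
qed

lemma support_add_particle: "support (add_particle \<eta> u) = insert u (support \<eta>)"
  by (auto simp: support_def add_particle_def)

lemma add_particle_commute: "add_particle (add_particle \<eta> u) v = add_particle (add_particle \<eta> v) u"
  by (auto simp: add_particle_def)

lemma add_particle_sector: "\<eta> \<in> sector N \<Longrightarrow> add_particle \<eta> u \<in> sector (Suc N)"
proof -
  assume *: "\<eta> \<in> sector N"
  hence fin: "finite (support \<eta>)" by (simp add: sector_def)
  let ?F = "insert u (support \<eta>)"
  have "sum (add_particle \<eta> u) ?F = (\<Sum>x\<in>?F. \<eta> x + (if x = u then 1 else 0))"
    by (intro sum.cong) (auto simp: add_particle_def)
  also have "\<dots> = sum \<eta> ?F + 1" using fin by (simp add: sum.distrib)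
  also have "\<dots> = Suc N" using sum_sector[OF *, of ?F] fin by auto
  finally show ?thesis using fin by (simp add: sector_def support_add_particle)
qed

lemma add_particle_sector_iff: "add_particle \<eta> u \<in> sector (Suc N) \<longleftrightarrow> \<eta> \<in> sector N"
proof
  assume *: "add_particle \<eta> u \<in> sector (Suc N)"
  have "finite (support \<eta>)"
    using * by (simp add: sector_def support_add_particle)
  hence "\<eta> \<in> sector (sum \<eta> (support \<eta>))" by (simp add: sector_def)
  moreover have "sum \<eta> (support \<eta>) = N"
    using add_particle_sector[OF calculation, of u] * by (auto simp: sector_def)
  ultimately show "\<eta> \<in> sector N" by simp
qed (rule add_particle_sector)

lemma obtain_add_particle:
  assumes "x \<in> support \<eta>"
  obtains \<xi> where "\<eta> = add_particle \<xi> x"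
  using assms by (intro that[of "\<eta>(x := \<eta> x - 1)"]) (auto simp: add_particle_def support_def)

text \<open>Naming the configuration \<open>\<xi>\<close> left behind by the departing particle
  removes the truncated subtraction in \<open>move\<close> and covers \<open>z = x\<close> without a
  case distinction.\<close>

lemma move_add_particle: "move (add_particle \<xi> x) x z = add_particle \<xi> z"
  by (auto simp: move_def add_particle_def Let_def)

lemma move_sector:
  assumes "\<eta> \<in> sector N" "x \<in> support \<eta>"
  shows "move \<eta> x z \<in> sector N"
proof -
  obtain \<xi> where \<xi>: "\<eta> = add_particle \<xi> x" using obtain_add_particle assms(2) .
  have "N = Suc (N - 1)"
    using assms by (cases N) (auto simp: sector_def support_def)
  with assms(1) have "\<xi> \<in> sector (N - 1)"
    unfolding \<xi> by (metis add_particle_sector_iff)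
  thus ?thesis using \<open>N = Suc (N - 1)\<close> add_particle_sector[of \<xi> "N - 1" z]
    by (simp add: \<xi> move_add_particle)
qed

text \<open>Occupation of \<open>x\<close> matters when \<open>u = x\<close>: on a vacant site
  \<open>move\<close> would create a particle on the right, whereas on the left it transports the
  one just added.\<close>

lemma move_add_particle_commute:
  assumes "x \<in> support \<eta>"
  shows "move (add_particle \<eta> u) x z = add_particle (move \<eta> x z) u"
proof -
  obtain \<xi> where \<xi>: "\<eta> = add_particle \<xi> x" using obtain_add_particle assms .
  show ?thesis unfolding \<xi>
    by (subst add_particle_commute) (simp add: move_add_particle add_particle_commute)
qed

text \<open>Lipschitz functions are in general unbounded on all finite configurations, but bounded
  for each particle number. The class is stable under \<open>gen\<close>, so every term of the
  exponential series stays in it.\<close>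

definition sector_bounded :: "(('a \<Rightarrow> nat) \<Rightarrow> real) \<Rightarrow> bool" where
  "sector_bounded f \<longleftrightarrow> (\<forall>N. \<exists>B. \<forall>\<eta>\<in>sector N. \<bar>f \<eta>\<bar> \<le> B)"

lemma sector_boundedE:
  assumes "sector_bounded f"
  obtains B where "B \<ge> 0" "\<And>\<eta>. \<eta> \<in> sector N \<Longrightarrow> \<bar>f \<eta>\<bar> \<le> B"
proof -
  obtain B where "\<forall>\<eta>\<in>sector N. \<bar>f \<eta>\<bar> \<le> B" using assms unfolding sector_bounded_def by blast
  thus thesis by (intro that[of "max B 0"]) force+
qed

lemma sector_boundedI:
  assumes "\<And>N \<eta>. \<eta> \<in> sector N \<Longrightarrow> \<bar>f \<eta>\<bar> \<le> B N"
  shows "sector_bounded f"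
  using assms unfolding sector_bounded_def by blast

lemma sector_bounded_lin:
  assumes "sector_bounded f" "sector_bounded h"
  shows "sector_bounded (\<lambda>\<eta>. a * f \<eta> + b * h \<eta>)"
  unfolding sector_bounded_def
proof
  fix N
  obtain B where B: "\<And>\<eta>. \<eta> \<in> sector N \<Longrightarrow> \<bar>f \<eta>\<bar> \<le> B" using sector_boundedE[OF assms(1)] by blast
  obtain C where C: "\<And>\<eta>. \<eta> \<in> sector N \<Longrightarrow> \<bar>h \<eta>\<bar> \<le> C" using sector_boundedE[OF assms(2)] by blast
  have "\<bar>a * f \<eta> + b * h \<eta>\<bar> \<le> \<bar>a\<bar> * B + \<bar>b\<bar> * C" if "\<eta> \<in> sector N" for \<eta>
  proof -
    have "\<bar>a * f \<eta> + b * h \<eta>\<bar> \<le> \<bar>a\<bar> * \<bar>f \<eta>\<bar> + \<bar>b\<bar> * \<bar>h \<eta>\<bar>"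
      by (simp only: abs_triangle_ineq flip: abs_mult)
    also have "\<dots> \<le> \<bar>a\<bar> * B + \<bar>b\<bar> * C"
      by (intro add_mono mult_left_mono B C that) auto
    finally show ?thesis .
  qed
  thus "\<exists>B. \<forall>\<eta>\<in>sector N. \<bar>a * f \<eta> + b * h \<eta>\<bar> \<le> B" by blast
qed

section \<open>The generator as a bounded operator on each sector\<close>

locale zero_range =
  fixes p :: "'d::finite site \<Rightarrow> 'd site pmf" and g :: "nat \<Rightarrow> real" and a0 :: real
  assumes g_0: "g 0 = 0"
    and g_nonneg: "0 \<le> g k"
    and g_lip: "\<bar>g (k + 1) - g k\<bar> \<le> a0"
begin

lemma a0_nonneg: "0 \<le> a0"
  using g_lip[of 0] by linarith

lemma g_le: "g k \<le> a0 * k"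
proof (induction k)
  case (Suc k)
  thus ?case using g_lip[of k] by (simp add: algebra_simps)
qed (simp add: g_0)

text \<open>This is \<open>zr_gen\<close> on finite configurations: summing over targets is an
  expectation under \<open>p x\<close>, and vacant sites drop out because \<open>g 0 = 0\<close>.
  The agreement is \<open>zr_gen_finite\<close>.\<close>

definition gen :: "('d config \<Rightarrow> real) \<Rightarrow> 'd config \<Rightarrow> real" where
  "gen f \<eta> = (\<Sum>x\<in>support \<eta>.
     g (\<eta> x) * (measure_pmf.expectation (p x) (\<lambda>z. f (move \<eta> x z)) - f \<eta>))"

lemma gen_eq_sum:
  assumes "finite F" "support \<eta> \<subseteq> F"
  shows "gen f \<eta> = (\<Sum>x\<in>F.
     g (\<eta> x) * (measure_pmf.expectation (p x) (\<lambda>z. f (move \<eta> x z)) - f \<eta>))"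
  unfolding gen_def using assms by (intro sum.mono_neutral_left) (auto simp: support_def g_0)

lemma sum_rate_le:
  assumes "\<eta> \<in> sector N"
  shows "(\<Sum>x\<in>support \<eta>. g (\<eta> x)) \<le> a0 * N"
proof -
  have "(\<Sum>x\<in>support \<eta>. g (\<eta> x)) \<le> (\<Sum>x\<in>support \<eta>. a0 * \<eta> x)" by (intro sum_mono g_le)
  also have "\<dots> = a0 * N" using assms by (simp add: sector_def flip: sum_distrib_left of_nat_sum)
  finally show ?thesis .
qed

lemma gen_cong:
  assumes "\<eta> \<in> sector N" "\<And>\<xi>. \<xi> \<in> sector N \<Longrightarrow> f \<xi> = h \<xi>"
  shows "gen f \<eta> = gen h \<eta>"
  unfolding gen_def using assms(2)[OF assms(1)] assms(2)[OF move_sector[OF assms(1)]]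
  by (intro sum.cong refl) simp

text \<open>Jumps occur at total rate at most \<open>a0 * N\<close>, and each changes the function
  by at most \<open>2 * B\<close>.\<close>

lemma gen_bound:
  assumes \<eta>: "\<eta> \<in> sector N" and f: "\<And>\<xi>. \<xi> \<in> sector N \<Longrightarrow> \<bar>f \<xi>\<bar> \<le> B"
  shows "\<bar>gen f \<eta>\<bar> \<le> 2 * a0 * N * B"
proof -
  have B: "0 \<le> B" using f[OF \<eta>] by linarith
  have "\<bar>gen f \<eta>\<bar> \<le> (\<Sum>x\<in>support \<eta>.
      \<bar>g (\<eta> x) * (measure_pmf.expectation (p x) (\<lambda>z. f (move \<eta> x z)) - f \<eta>)\<bar>)"
    unfolding gen_def by (rule sum_abs)
  also have "\<dots> \<le> (\<Sum>x\<in>support \<eta>. g (\<eta> x) * (2 * B))"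
  proof (rule sum_mono)
    fix x assume x: "x \<in> support \<eta>"
    have "\<bar>measure_pmf.expectation (p x) (\<lambda>z. f (move \<eta> x z))\<bar> \<le> B"
      by (intro abs_expectation_pmf_le f move_sector[OF \<eta> x])
    hence "\<bar>measure_pmf.expectation (p x) (\<lambda>z. f (move \<eta> x z)) - f \<eta>\<bar> \<le> 2 * B"
      using f[OF \<eta>] by linarith
    thus "\<bar>g (\<eta> x) * (measure_pmf.expectation (p x) (\<lambda>z. f (move \<eta> x z)) - f \<eta>)\<bar>
        \<le> g (\<eta> x) * (2 * B)"
      using g_nonneg[of "\<eta> x"] by (auto simp: abs_mult intro: mult_left_mono)
  qed
  also have "\<dots> = (\<Sum>x\<in>support \<eta>. g (\<eta> x)) * (2 * B)" by (rule sum_distrib_right[symmetric])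
  also have "\<dots> \<le> (a0 * N) * (2 * B)"
    using B by (intro mult_right_mono sum_rate_le[OF \<eta>]) auto
  finally show ?thesis by (simp add: algebra_simps)
qed

lemma integrable_move:
  assumes "sector_bounded f" "\<eta> \<in> sector N" "x \<in> support \<eta>"
  shows "integrable (measure_pmf (p x)) (\<lambda>z. f (move \<eta> x z))"
proof -
  obtain B where "\<And>\<xi>. \<xi> \<in> sector N \<Longrightarrow> \<bar>f \<xi>\<bar> \<le> B" using sector_boundedE[OF assms(1)] by blast
  thus ?thesis using move_sector[OF assms(2,3)] by (intro integrable_pmf_bounded) auto
qed

lemma gen_lin:
  assumes f: "sector_bounded f" and h: "sector_bounded h" and \<eta>: "\<eta> \<in> sector N"
  shows "gen (\<lambda>\<xi>. a * f \<xi> + b * h \<xi>) \<eta> = a * gen f \<eta> + b * gen h \<eta>"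
  unfolding gen_def sum_distrib_left sum.distrib[symmetric]
  using integrable_move[OF f \<eta>] integrable_move[OF h \<eta>]
  by (intro sum.cong refl) (simp add: algebra_simps)

lemma sector_bounded_gen: "sector_bounded f \<Longrightarrow> sector_bounded (gen f)"
  unfolding sector_bounded_def by (meson gen_bound)

text \<open>Only finitely many sites are occupied, so the interchange is an issue only for the
  expectations under \<open>p x\<close>, where the summable bound settles it.\<close>

lemma gen_suminf:
  assumes \<eta>: "\<eta> \<in> sector N" and B: "summable B"
    and f: "\<And>n \<xi>. \<xi> \<in> sector N \<Longrightarrow> \<bar>f n \<xi>\<bar> \<le> B n"
  shows "(\<lambda>n. gen (f n) \<eta>) sums gen (\<lambda>\<xi>. \<Sum>n. f n \<xi>) \<eta>"
  unfolding gen_def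
proof (intro sums_sum sums_mult sums_diff)
  fix x assume x: "x \<in> support \<eta>"
  note mv = f[OF move_sector[OF \<eta> x]]
  show "(\<lambda>n. measure_pmf.expectation (p x) (\<lambda>z. f n (move \<eta> x z))) sums
      measure_pmf.expectation (p x) (\<lambda>z. \<Sum>n. f n (move \<eta> x z))"
  proof (rule sums_integral)
    show "integrable (measure_pmf (p x)) (\<lambda>z. f n (move \<eta> x z))" for n
      using mv by (intro integrable_pmf_bounded)
    show "AE z in measure_pmf (p x). summable (\<lambda>n. norm (f n (move \<eta> x z)))"
      using mv by (intro AE_pmfI summable_comparison_test'[OF B, of 0]) auto
    show "summable (\<lambda>n. measure_pmf.expectation (p x) (\<lambda>z. norm (f n (move \<eta> x z))))"
      using mv by (intro summable_comparison_test'[OF B, of 0])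
        (simp only: real_norm_def, rule abs_expectation_pmf_le, simp)
  qed
next
  have "summable (\<lambda>n. f n \<eta>)"
    using f[OF \<eta>] by (intro summable_comparison_test'[OF B, of 0]) auto
  thus "(\<lambda>n. f n \<eta>) sums (\<Sum>n. f n \<eta>)" by (rule summable_sums)
qed

lemma gen_tendsto:
  assumes \<eta>: "\<eta> \<in> sector N" 
    and f: "\<And>n \<xi>. \<xi> \<in> sector N \<Longrightarrow> \<bar>f n \<xi>\<bar> \<le> B"
    and lim: "\<And>\<xi>. \<xi> \<in> sector N \<Longrightarrow> (\<lambda>n. f n \<xi>) \<longlonglongrightarrow> h \<xi>"
  shows "(\<lambda>n. gen (f n) \<eta>) \<longlonglongrightarrow> gen h \<eta>"
  unfolding gen_def
proof (intro tendsto_sum tendsto_mult tendsto_const tendsto_diff lim \<eta>)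
  fix x assume x: "x \<in> support \<eta>"
  show "(\<lambda>n. measure_pmf.expectation (p x) (\<lambda>z. f n (move \<eta> x z))) \<longlonglongrightarrow>
      measure_pmf.expectation (p x) (\<lambda>z. h (move \<eta> x z))"
    by (rule integral_dominated_convergence[where w = "\<lambda>_. B"])
      (auto intro!: AE_pmfI lim f move_sector[OF \<eta> x])
qed

section \<open>The semigroup on finite configurations\<close>

definition shift :: "real \<Rightarrow> ('d config \<Rightarrow> real) \<Rightarrow> 'd config \<Rightarrow> real" where
  "shift l f \<eta> = gen f \<eta> + l * f \<eta>"

lemma shift_pow_bound:
  assumes f: "\<And>\<xi>. \<xi> \<in> sector N \<Longrightarrow> \<bar>f \<xi>\<bar> \<le> B" and \<eta>: "\<eta> \<in> sector N"
  shows "\<bar>(shift l ^^ n) f \<eta>\<bar> \<le> (2 * a0 * N + \<bar>l\<bar>) ^ n * B"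
  using \<eta>
proof (induction n arbitrary: \<eta>)
  case 0
  thus ?case using f by simp
next
  case (Suc n)
  let ?h = "(shift l ^^ n) f" and ?B = "(2 * a0 * N + \<bar>l\<bar>) ^ n * B"
  have "\<bar>shift l ?h \<eta>\<bar> \<le> \<bar>gen ?h \<eta>\<bar> + \<bar>l\<bar> * \<bar>?h \<eta>\<bar>"
    unfolding shift_def by (simp only: abs_triangle_ineq flip: abs_mult)
  also have "\<dots> \<le> 2 * a0 * N * ?B + \<bar>l\<bar> * ?B"
    by (intro add_mono mult_left_mono gen_bound Suc) auto
  finally show ?case by (simp add: algebra_simps)
qed

lemma sector_bounded_shift: "sector_bounded f \<Longrightarrow> sector_bounded (shift l f)"
  unfolding shift_def[abs_def] using sector_bounded_lin[OF sector_bounded_gen, of f f 1 l] by simp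

lemma sector_bounded_shift_pow: "sector_bounded f \<Longrightarrow> sector_bounded ((shift l ^^ n) f)"
  by (induction n) (auto intro: sector_bounded_shift)

section \<open>The exponential series of \<open>L + l\<close> and the backward equation\<close>

definition exp_shift :: "real \<Rightarrow> real \<Rightarrow> ('d config \<Rightarrow> real) \<Rightarrow> 'd config \<Rightarrow> real" where
  "exp_shift l t f \<eta> = (\<Sum>n. (shift l ^^ n) f \<eta> / fact n * t ^ n)"

lemma exp_shift_term_bound:
  assumes f: "\<And>\<xi>. \<xi> \<in> sector N \<Longrightarrow> \<bar>f \<xi>\<bar> \<le> B" and \<eta>: "\<eta> \<in> sector N"
  shows "\<bar>(shift l ^^ n) f \<eta> / fact n * t ^ n\<bar> \<le> B * (((2 * a0 * N + \<bar>l\<bar>) * \<bar>t\<bar>) ^ n / fact n)"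
proof -
  have "\<bar>(shift l ^^ n) f \<eta> / fact n * t ^ n\<bar> = \<bar>(shift l ^^ n) f \<eta>\<bar> * (\<bar>t\<bar> ^ n / fact n)"
    by (simp add: abs_mult power_abs)
  also have "\<dots> \<le> (2 * a0 * N + \<bar>l\<bar>) ^ n * B * (\<bar>t\<bar> ^ n / fact n)"
    by (intro mult_right_mono shift_pow_bound f \<eta>) auto
  finally show ?thesis by (simp add: power_mult_distrib mult_ac)
qed

lemma exp_series: "(\<lambda>n. B * (c ^ n / fact n)) sums (B * exp c)" for B c :: real
  using exp_converges[of c] by (intro sums_mult) (simp add: field_simps)

lemma summable_exp_shift:
  assumes "sector_bounded f" and \<eta>: "\<eta> \<in> sector N"
  shows "summable (\<lambda>n. (shift l ^^ n) f \<eta> / fact n * t ^ n)"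
proof -
  obtain B where B: "\<And>\<xi>. \<xi> \<in> sector N \<Longrightarrow> \<bar>f \<xi>\<bar> \<le> B" using sector_boundedE[OF assms(1)] by blast
  show ?thesis
    by (rule summable_comparison_test'[OF sums_summable[OF exp_series], of 0])
      (use exp_shift_term_bound[OF B \<eta>] in auto)
qed

lemma abs_exp_shift_le:
  assumes f: "\<And>\<xi>. \<xi> \<in> sector N \<Longrightarrow> \<bar>f \<xi>\<bar> \<le> B" and \<eta>: "\<eta> \<in> sector N"
  shows "\<bar>exp_shift l t f \<eta>\<bar> \<le> B * exp ((2 * a0 * N + \<bar>l\<bar>) * \<bar>t\<bar>)"
proof -
  let ?b = "\<lambda>n. B * (((2 * a0 * N + \<bar>l\<bar>) * \<bar>t\<bar>) ^ n / fact n)"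
  have "norm (exp_shift l t f \<eta>) \<le> suminf ?b"
    unfolding exp_shift_def
    by (rule norm_suminf_le) (use exp_shift_term_bound[OF f \<eta>] exp_series in \<open>auto simp: sums_iff\<close>)
  thus ?thesis using exp_series by (simp add: sums_iff)
qed

lemma gen_exp_shift:
  assumes "sector_bounded f" and \<eta>: "\<eta> \<in> sector N"
  shows "(\<lambda>n. gen ((shift l ^^ n) f) \<eta> / fact n * t ^ n) sums gen (exp_shift l t f) \<eta>"
proof -
  obtain B where B: "\<And>\<xi>. \<xi> \<in> sector N \<Longrightarrow> \<bar>f \<xi>\<bar> \<le> B" using sector_boundedE[OF assms(1)] by blast
  have eq: "gen (\<lambda>\<xi>. (shift l ^^ n) f \<xi> / fact n * t ^ n) \<eta> =
      gen ((shift l ^^ n) f) \<eta> / fact n * t ^ n" for n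
    using gen_lin[OF sector_bounded_shift_pow[OF assms(1)] sector_bounded_shift_pow[OF assms(1)] \<eta>,
      where a = "t ^ n / fact n" and b = 0] by (simp add: mult_ac)
  have "(\<lambda>n. gen (\<lambda>\<xi>. (shift l ^^ n) f \<xi> / fact n * t ^ n) \<eta>) sums gen (exp_shift l t f) \<eta>"
    unfolding exp_shift_def[abs_def]
    by (rule gen_suminf[OF \<eta> sums_summable[OF exp_series] exp_shift_term_bound[OF B]])
  thus ?thesis unfolding eq .
qed

lemma exp_shift_deriv:
  assumes f: "sector_bounded f" and \<eta>: "\<eta> \<in> sector N"
  shows "((\<lambda>t. exp_shift l t f \<eta>) has_real_derivative
    gen (exp_shift l t f) \<eta> + l * exp_shift l t f \<eta>) (at t)"
proof -
  let ?c = "\<lambda>n. (shift l ^^ n) f \<eta> / fact n"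
  \<comment> \<open>\<open>diffs\<close> multiplies the coefficient of index n + 1 by n + 1, which
    turns (n + 1)! into n!; the surplus factor \<open>shift l\<close> splits into \<open>gen\<close>
    and \<open>l\<close>.\<close>
  have diffs: "diffs ?c n * t ^ n = gen ((shift l ^^ n) f) \<eta> / fact n * t ^ n + l * (?c n * t ^ n)"
    for n
  proof -
    have "diffs ?c n = shift l ((shift l ^^ n) f) \<eta> / fact n"
      by (simp add: diffs_def field_simps del: of_nat_Suc)
    thus ?thesis by (simp add: shift_def add_divide_distrib distrib_right)
  qed
  have "(\<lambda>n. gen ((shift l ^^ n) f) \<eta> / fact n * t ^ n + l * (?c n * t ^ n)) sums
      (gen (exp_shift l t f) \<eta> + l * exp_shift l t f \<eta>)"
    unfolding exp_shift_def[of l t f \<eta>]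
    by (intro sums_add sums_mult gen_exp_shift[OF f \<eta>] summable_sums summable_exp_shift[OF f \<eta>])
  hence sum: "(\<Sum>n. diffs ?c n * t ^ n) = gen (exp_shift l t f) \<eta> + l * exp_shift l t f \<eta>"
    unfolding diffs by (simp add: sums_iff)
  show ?thesis
    using termdiffs_strong_converges_everywhere[of ?c t, OF summable_exp_shift[OF f \<eta>]]
    unfolding sum unfolding exp_shift_def .
qed

text \<open>The value does not depend on \<open>l\<close>; a large \<open>l\<close> makes \<open>L + l\<close> a positive operator on the
  configurations with at most a given number of particles.\<close>

definition heat :: "real \<Rightarrow> real \<Rightarrow> ('d config \<Rightarrow> real) \<Rightarrow> 'd config \<Rightarrow> real" where
  "heat l t f \<eta> = exp (- l * t) * exp_shift l t f \<eta>"

lemma heat_0: "heat l 0 f \<eta> = f \<eta>"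
proof -
  have "(\<lambda>n. (shift l ^^ n) f \<eta> / fact n * 0 ^ n) sums ((shift l ^^ 0) f \<eta> / fact 0)"
    using powser_sums_zero[of "\<lambda>n. (shift l ^^ n) f \<eta> / fact n"] by simp
  thus ?thesis by (simp add: heat_def exp_shift_def sums_iff)
qed

text \<open>Deliberately crude: what counts is uniformity over the sector and over bounded times,
  for dominated convergence and for the uniqueness argument. \<open>\<bar>l\<bar>\<close> enters
  twice, from the series and from the prefactor, as \<open>l\<close> may have either sign.\<close>

lemma heat_bound:
  assumes f: "\<And>\<xi>. \<xi> \<in> sector N \<Longrightarrow> \<bar>f \<xi>\<bar> \<le> B" and \<eta>: "\<eta> \<in> sector N" and t: "0 \<le> t" "t \<le> T"
  shows "\<bar>heat l t f \<eta>\<bar> \<le> B * exp ((2 * a0 * N + 2 * \<bar>l\<bar>) * T)"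
proof -
  have B: "0 \<le> B" using f[OF \<eta>] by linarith
  have "\<bar>heat l t f \<eta>\<bar> = exp (- l * t) * \<bar>exp_shift l t f \<eta>\<bar>" by (simp add: heat_def abs_mult)
  also have "\<dots> \<le> exp (- l * t) * (B * exp ((2 * a0 * N + \<bar>l\<bar>) * \<bar>t\<bar>))"
    by (intro mult_left_mono abs_exp_shift_le f \<eta>) auto
  also have "\<dots> = B * exp (- l * t + (2 * a0 * N + \<bar>l\<bar>) * t)"
    using t by (simp add: exp_add[symmetric] mult.left_commute)
  also have "\<dots> \<le> B * exp ((2 * a0 * N + 2 * \<bar>l\<bar>) * T)"
  proof (intro mult_left_mono B, simp only: exp_le_cancel_iff)
    have "- l * t \<le> \<bar>l\<bar> * t" using t by (intro mult_right_mono) auto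
    moreover have "(2 * a0 * N + 2 * \<bar>l\<bar>) * t \<le> (2 * a0 * N + 2 * \<bar>l\<bar>) * T"
      using t a0_nonneg by (intro mult_left_mono) auto
    ultimately show "- l * t + (2 * a0 * N + \<bar>l\<bar>) * t \<le> (2 * a0 * N + 2 * \<bar>l\<bar>) * T"
      by (simp add: algebra_simps)
  qed
  finally show ?thesis .
qed

lemma sector_bounded_exp_shift: "sector_bounded f \<Longrightarrow> sector_bounded (exp_shift l t f)"
  unfolding sector_bounded_def by (meson abs_exp_shift_le)

lemma sector_bounded_heat: "sector_bounded f \<Longrightarrow> sector_bounded (heat l t f)"
  unfolding heat_def[abs_def]
  using sector_bounded_lin[of "exp_shift l t f" "exp_shift l t f" "exp (- l * t)" 0]
  by (simp add: sector_bounded_exp_shift)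

text \<open>The prefactor contributes \<open>- l\<close>, cancelling the \<open>l\<close> of
  \<open>exp_shift_deriv\<close>; all values of \<open>l\<close> thus lead to the same backward
  equation.\<close>

lemma heat_deriv:
  assumes f: "sector_bounded f" and \<eta>: "\<eta> \<in> sector N"
  shows "((\<lambda>t. heat l t f \<eta>) has_real_derivative gen (heat l t f) \<eta>) (at t)"
proof -
  have "gen (heat l t f) \<eta> = exp (- l * t) * gen (exp_shift l t f) \<eta>"
    unfolding heat_def[abs_def]
    using gen_lin[OF sector_bounded_exp_shift[OF f] sector_bounded_exp_shift[OF f] \<eta>,
      where a = "exp (- l * t)" and b = 0] by simp
  thus ?thesis
    unfolding heat_def
    by (auto intro!: derivative_eq_intros exp_shift_deriv[OF f \<eta>] simp: algebra_simps)
qed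

lemma continuous_on_gen_heat:
  assumes f: "sector_bounded f" and \<eta>: "\<eta> \<in> sector N"
  shows "continuous_on {0..} (\<lambda>t. gen (heat l t f) \<eta>)"
  unfolding continuous_on_sequentially
proof (intro ballI allI impI)
  fix s :: real and u :: "nat \<Rightarrow> real"
  assume "s \<in> {0..}" and u: "(\<forall>n. u n \<in> {0..}) \<and> u \<longlonglongrightarrow> s"
  \<comment> \<open>A convergent sequence of times stays below some \<open>T\<close>, which makes
    the bound of \<open>heat_bound\<close> the same for all its members.\<close>
  from u have "Bseq u" by (auto intro: convergent_imp_Bseq convergentI)
  then obtain T where T: "\<And>n. \<bar>u n\<bar> \<le> T" by (auto simp: Bseq_def)
  obtain B where B: "\<And>\<xi>. \<xi> \<in> sector N \<Longrightarrow> \<bar>f \<xi>\<bar> \<le> B" using sector_boundedE[OF f] by blast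
  show "((\<lambda>t. gen (heat l t f) \<eta>) \<circ> u) \<longlonglongrightarrow> gen (heat l s f) \<eta>"
    unfolding o_def
  proof (rule gen_tendsto[OF \<eta>])
    fix n and \<xi> :: "'d config" assume \<xi>: "\<xi> \<in> sector N"
    show "\<bar>heat l (u n) f \<xi>\<bar> \<le> B * exp ((2 * a0 * N + 2 * \<bar>l\<bar>) * T)"
      using u T[of n] by (intro heat_bound B \<xi>) auto
    show "(\<lambda>n. heat l (u n) f \<xi>) \<longlonglongrightarrow> heat l s f \<xi>"
      using isCont_tendsto_compose[OF DERIV_isCont[OF heat_deriv[OF f \<xi>]]] u by blast
  qed
qed

text \<open>Iterating the derivative bound gives \<open>B (2 a\<^sub>0 N t)\<^sup>n / n!\<close> for every \<open>n\<close>.\<close>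

lemma backward_equation_zero:
  assumes bnd: "\<And>t \<eta>. \<eta> \<in> sector N \<Longrightarrow> 0 \<le> t \<Longrightarrow> t \<le> T \<Longrightarrow> \<bar>w t \<eta>\<bar> \<le> B"
    and cont: "\<And>\<eta>. \<eta> \<in> sector N \<Longrightarrow> continuous_on {0..T} (\<lambda>t. w t \<eta>)"
    and deriv: "\<And>t \<eta>. \<eta> \<in> sector N \<Longrightarrow> 0 < t \<Longrightarrow> t < T \<Longrightarrow>
      ((\<lambda>t. w t \<eta>) has_real_derivative gen (w t) \<eta>) (at t)"
    and init: "\<And>\<eta>. \<eta> \<in> sector N \<Longrightarrow> w 0 \<eta> = 0"
    and \<eta>: "\<eta> \<in> sector N" and t: "0 \<le> t" "t \<le> T"
  shows "w t \<eta> = 0"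
proof -
  let ?C = "2 * a0 * N"
  have iter: "\<bar>w t \<eta>\<bar> \<le> B * ((?C * t) ^ n / fact n)"
    if "\<eta> \<in> sector N" "0 \<le> t" "t \<le> T" for n t \<eta>
    using that
  proof (induction n arbitrary: t \<eta>)
    case 0
    thus ?case using bnd by simp
  next
    case (Suc n)
    show ?case
    proof (cases "t = 0")
      case True
      thus ?thesis using init Suc.prems by simp
    next
      case False
      hence "0 < t" using Suc.prems by simp
      let ?\<phi> = "\<lambda>s. B * ((?C * s) ^ Suc n / fact (Suc n))"
      have \<phi>: "(?\<phi> has_real_derivative ?C * (B * ((?C * s) ^ n / fact n))) (at s)" for s
        by (rule derivative_eq_intros refl | simp)+
      \<comment> \<open>\<open>?\<phi>\<close> vanishes at 0 and its derivative is what
        \<open>gen_bound\<close> makes of the n-th estimate, so comparing derivatives gains one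
        power of time and one factor of the factorial.\<close>
      have "norm (w t \<eta> - w 0 \<eta>) \<le> ?\<phi> t - ?\<phi> 0"
      proof (rule differentiable_bound_general[OF \<open>0 < t\<close>])
        show "continuous_on {0..t} (\<lambda>s. w s \<eta>)"
          using cont[OF Suc.prems(1)] by (rule continuous_on_subset) (use Suc.prems in auto)
        show "continuous_on {0..t} ?\<phi>" by (intro continuous_intros) auto
        fix s assume s: "0 < s" "s < t"
        show "((\<lambda>s. w s \<eta>) has_vector_derivative gen (w s) \<eta>) (at s)"
          using deriv[OF Suc.prems(1)] s Suc.prems
          by (auto simp: has_real_derivative_iff_has_vector_derivative)
        show "(?\<phi> has_vector_derivative ?C * (B * ((?C * s) ^ n / fact n))) (at s)"
          using \<phi> by (simp only: has_real_derivative_iff_has_vector_derivative)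
        show "norm (gen (w s) \<eta>) \<le> ?C * (B * ((?C * s) ^ n / fact n))"
          unfolding real_norm_def using s Suc.prems by (intro gen_bound Suc.IH) auto
      qed
      thus ?thesis using init[OF Suc.prems(1)] by simp
    qed
  qed
  have "(\<lambda>n. B * ((?C * t) ^ n / fact n)) \<longlonglongrightarrow> 0"
    using summable_LIMSEQ_zero[OF sums_summable[OF exp_series]] .
  hence "\<bar>w t \<eta>\<bar> \<le> 0"
    by (rule LIMSEQ_le_const) (use iter[OF \<eta> t] in blast)
  thus ?thesis by simp
qed

lemma backward_equation_unique:
  assumes bnd: "\<And>t \<eta>. \<eta> \<in> sector N \<Longrightarrow> 0 \<le> t \<Longrightarrow> t \<le> T \<Longrightarrow> \<bar>v t \<eta>\<bar> \<le> B"
    and cont: "\<And>\<eta>. \<eta> \<in> sector N \<Longrightarrow> continuous_on {0..T} (\<lambda>t. v t \<eta>)"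
    and deriv: "\<And>t \<eta>. \<eta> \<in> sector N \<Longrightarrow> 0 < t \<Longrightarrow> t < T \<Longrightarrow>
      ((\<lambda>t. v t \<eta>) has_real_derivative gen (v t) \<eta>) (at t)"
    and vsb: "\<And>t. 0 \<le> t \<Longrightarrow> t \<le> T \<Longrightarrow> sector_bounded (v t)"
    and f: "sector_bounded f" "\<And>\<eta>. \<eta> \<in> sector N \<Longrightarrow> v 0 \<eta> = f \<eta>"
    and \<eta>: "\<eta> \<in> sector N" and t: "0 \<le> t" "t \<le> T"
  shows "v t \<eta> = heat l t f \<eta>"
proof -
  obtain C where C: "\<And>\<xi>. \<xi> \<in> sector N \<Longrightarrow> \<bar>f \<xi>\<bar> \<le> C" using sector_boundedE[OF f(1)] by blast
  \<comment> \<open>The difference is written with coefficients \<open>1\<close> and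
    \<open>-1\<close> so that it has the shape of \<open>gen_lin\<close>.\<close>
  let ?w = "\<lambda>t \<eta>. 1 * v t \<eta> + (-1) * heat l t f \<eta>"
  have "?w t \<eta> = 0"
  proof (rule backward_equation_zero[OF _ _ _ _ \<eta> t])
    fix t and \<xi> :: "'d config" assume \<xi>: "\<xi> \<in> sector N"
    show "\<bar>?w t \<xi>\<bar> \<le> B + C * exp ((2 * a0 * N + 2 * \<bar>l\<bar>) * T)" if "0 \<le> t" "t \<le> T"
      using bnd[OF \<xi> that] heat_bound[where f = f and l = l, OF C \<xi> that] by linarith
    show "continuous_on {0..T} (\<lambda>t. ?w t \<xi>)"
      by (intro continuous_intros cont[OF \<xi>] DERIV_continuous_on[OF has_field_derivative_at_within[OF heat_deriv[OF f(1) \<xi>]]])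
    show "?w 0 \<xi> = 0" using f(2)[OF \<xi>] by (simp add: heat_0)
    assume t: "0 < t" "t < T"
    have "gen (?w t) \<xi> = 1 * gen (v t) \<xi> + (-1) * gen (heat l t f) \<xi>"
      using t by (intro gen_lin[OF _ _ \<xi>] vsb sector_bounded_heat f) auto
    thus "((\<lambda>t. ?w t \<xi>) has_real_derivative gen (?w t) \<xi>) (at t)"
      by (auto intro!: derivative_eq_intros deriv[OF \<xi> t] heat_deriv[OF f(1) \<xi>])
  qed
  thus ?thesis by simp
qed

text \<open>As functions of \<open>t\<close>, both sides solve the same backward equation with
  initial value \<open>heat k s f\<close>. Two separate parameters let one uniqueness argument give
  both the semigroup law (\<open>k = l\<close>) and independence of the parameter
  (\<open>s = 0\<close>).\<close>

lemma heat_semigroup_shift: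
  assumes f: "sector_bounded f" and \<eta>: "\<eta> \<in> sector N" and t: "0 \<le> t" and s: "0 \<le> s"
  shows "heat k (t + s) f \<eta> = heat l t (heat k s f) \<eta>"
proof -
  obtain B where B: "\<And>\<xi>. \<xi> \<in> sector N \<Longrightarrow> \<bar>f \<xi>\<bar> \<le> B" using sector_boundedE[OF f] by blast
  show ?thesis
  proof (rule backward_equation_unique[where v = "\<lambda>t. heat k (t + s) f" and T = t, OF _ _ _ _ _ _ \<eta> t order_refl])
    fix u and \<xi> :: "'d config" assume \<xi>: "\<xi> \<in> sector N"
    show "\<bar>heat k (u + s) f \<xi>\<bar> \<le> B * exp ((2 * a0 * N + 2 * \<bar>k\<bar>) * (t + s))" if "0 \<le> u" "u \<le> t"
      by (intro heat_bound B \<xi>) (use that s in auto)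
    have d: "((\<lambda>u. heat k (u + s) f \<xi>) has_real_derivative gen (heat k (u + s) f) \<xi>) (at u)" for u
      using heat_deriv[OF f \<xi>, of k "u + s"] by (simp add: DERIV_shift)
    show "continuous_on {0..t} (\<lambda>u. heat k (u + s) f \<xi>)"
      by (rule DERIV_continuous_on[OF has_field_derivative_at_within[OF d]])
    show "((\<lambda>u. heat k (u + s) f \<xi>) has_real_derivative gen (heat k (u + s) f) \<xi>) (at u)" by (rule d)
  qed (auto intro: sector_bounded_heat f)
qed

lemma heat_indep:
  assumes "sector_bounded f" "\<eta> \<in> sector N" "0 \<le> t"
  shows "heat k t f \<eta> = heat l t f \<eta>"
  using heat_semigroup_shift[OF assms order_refl, where k = k and l = l] by (simp add: heat_0[abs_def])

end

section \<open>Lipschitz bounds on finite configurations\<close>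

lemma cdist_finite:
  assumes "finite F" "\<And>x. x \<notin> F \<Longrightarrow> \<eta> x = \<zeta> x"
  shows "cdist p \<eta> \<zeta> = (\<Sum>x\<in>F. \<bar>real (\<eta> x) - real (\<zeta> x)\<bar> * beta p x)"
proof -
  have "cdist p \<eta> \<zeta> = infsum (\<lambda>x. \<bar>real (\<eta> x) - real (\<zeta> x)\<bar> * beta p x) F"
    unfolding cdist_def by (rule infsum_cong_neutral) (use assms in auto)
  thus ?thesis using assms(1) by simp
qed

lemma cdist_commute: "cdist p \<eta> \<zeta> = cdist p \<zeta> \<eta>"
  unfolding cdist_def by (simp add: abs_minus_commute)

lemma cdist_add_particle: "cdist p (add_particle \<eta> u) \<eta> = beta p u"
  by (subst cdist_finite[of "{u}"]) (auto simp: add_particle_def)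

text \<open>Two finite configurations are joined by a path which only ever removes particles, so the
  number of particles stays below its initial value.\<close>

lemma lipschitz_of_add_particle:
  fixes f :: "'d::finite config \<Rightarrow> real"
  assumes step: "\<And>M \<xi> u. M < N \<Longrightarrow> \<xi> \<in> sector M \<Longrightarrow> \<bar>f (add_particle \<xi> u) - f \<xi>\<bar> \<le> c * beta p u"
    and "\<eta> \<in> sector M" "M \<le> N" "\<zeta> \<in> sector M'" "M' \<le> N"
  shows "\<bar>f \<eta> - f \<zeta>\<bar> \<le> c * cdist p \<eta> \<zeta>"
  using assms(2-)
proof (induction "M + M'" arbitrary: \<eta> \<zeta> M M' rule: less_induct)
  case less
  \<comment> \<open>Stated for an arbitrary pair so that it can also be applied with the two
    configurations exchanged.\<close>
  have remove: "\<bar>f \<eta> - f \<zeta>\<bar> \<le> c * cdist p \<eta> \<zeta>"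
    if "\<zeta> x < \<eta> x" "\<eta> \<in> sector M" "M \<le> N" "\<zeta> \<in> sector M'" "M' \<le> N"
      and IH: "\<And>\<xi> K. \<xi> \<in> sector K \<Longrightarrow> Suc K = M \<Longrightarrow> \<bar>f \<xi> - f \<zeta>\<bar> \<le> c * cdist p \<xi> \<zeta>"
    for \<eta> \<zeta> x M M'
  proof -
    have "x \<in> support \<eta>" using that by (simp add: support_def)
    then obtain \<xi> where \<xi>: "\<eta> = add_particle \<xi> x" by (rule obtain_add_particle)
    define K where "K = sum \<xi> (support \<xi>)"
    have \<xi>K: "\<xi> \<in> sector K"
      using that(2) by (simp add: \<xi> K_def sector_def support_add_particle)
    have K: "M = Suc K"
      using add_particle_sector[OF \<xi>K, of x] that(2) by (simp add: \<xi> sector_def)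
    let ?F = "insert x (support \<xi> \<union> support \<zeta>)"
    have fin: "finite ?F" using \<xi>K that by (auto simp: sector_def)
    have "cdist p \<eta> \<zeta> = (\<Sum>y\<in>?F. \<bar>real (\<eta> y) - real (\<zeta> y)\<bar> * beta p y)"
      by (intro cdist_finite fin) (auto simp: \<xi> add_particle_def support_def)
    \<comment> \<open>At \<open>x\<close> there is a surplus of \<open>\<eta>\<close> over
      \<open>\<zeta>\<close>, so the removal lowers the distance by exactly \<open>beta p x\<close>:
      the path has no detours and the constant \<open>c\<close> is not lost.\<close>
    also have "\<dots> = (\<Sum>y\<in>?F. \<bar>real (\<xi> y) - real (\<zeta> y)\<bar> * beta p y + (if y = x then beta p x else 0))"
      using that(1) by (intro sum.cong) (auto simp: \<xi> add_particle_def algebra_simps)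
    also have "\<dots> = (\<Sum>y\<in>?F. \<bar>real (\<xi> y) - real (\<zeta> y)\<bar> * beta p y) + beta p x"
      using fin by (simp add: sum.distrib)
    also have "(\<Sum>y\<in>?F. \<bar>real (\<xi> y) - real (\<zeta> y)\<bar> * beta p y) = cdist p \<xi> \<zeta>"
      by (intro cdist_finite[symmetric] fin) (auto simp: support_def)
    finally have d: "cdist p \<eta> \<zeta> = cdist p \<xi> \<zeta> + beta p x" .
    have "\<bar>f \<eta> - f \<xi>\<bar> \<le> c * beta p x"
      unfolding \<xi> using that K by (intro step[OF _ \<xi>K]) auto
    with IH[OF \<xi>K] K show ?thesis unfolding d by (simp add: algebra_simps)
  qed
  consider "\<eta> = \<zeta>" | x where "\<zeta> x < \<eta> x" | x where "\<eta> x < \<zeta> x"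
    by (metis ext linorder_neqE_nat)
  thus ?case
  proof cases
    case 1
    thus ?thesis by (simp add: cdist_def)
  next
    case 2
    show ?thesis
    proof (rule remove[OF 2 less.prems])
      fix \<xi> :: "'d config" and K assume "\<xi> \<in> sector K" "Suc K = M"
      thus "\<bar>f \<xi> - f \<zeta>\<bar> \<le> c * cdist p \<xi> \<zeta>"
        using less.prems by (intro less.hyps[of K M']) auto
    qed
  next
    case 3
    have "\<bar>f \<zeta> - f \<eta>\<bar> \<le> c * cdist p \<zeta> \<eta>"
    proof (rule remove[OF 3 less.prems(3,4,1,2)])
      fix \<xi> :: "'d config" and K assume "\<xi> \<in> sector K" "Suc K = M'"
      hence "\<bar>f \<eta> - f \<xi>\<bar> \<le> c * cdist p \<eta> \<xi>"
        using less.prems by (intro less.hyps[of M K]) auto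
      thus "\<bar>f \<xi> - f \<eta>\<bar> \<le> c * cdist p \<xi> \<eta>" by (simp add: abs_minus_commute cdist_commute)
    qed
    thus ?thesis by (simp add: abs_minus_commute cdist_commute)
  qed
qed

section \<open>Propagation of Lipschitz constants through \<open>L + l\<close> and its
  exponential\<close>

context zero_range
begin

text \<open>The added particle changes only the rate at \<open>u\<close>. Splitting
  \<open>g (\<eta> u + 1)\<close> into \<open>g (\<eta> u)\<close> and the increment leaves the
  jumps of \<open>\<eta>\<close> carrying the extra particle along, plus the jump of the extra
  particle itself at the incremental rate.\<close>

lemma gen_add_particle:
  assumes \<eta>: "\<eta> \<in> sector M"
  shows "gen f (add_particle \<eta> u) = gen (\<lambda>\<xi>. f (add_particle \<xi> u)) \<eta> +
    (g (\<eta> u + 1) - g (\<eta> u)) *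
      (measure_pmf.expectation (p u) (\<lambda>z. f (add_particle \<eta> z)) - f (add_particle \<eta> u))"
    (is "_ = _ + ?D")
proof -
  let ?F = "insert u (support \<eta>)"
  have fin: "finite ?F" using \<eta> by (simp add: sector_def)
  let ?t = "\<lambda>x. g (\<eta> x) *
      (measure_pmf.expectation (p x) (\<lambda>z. f (add_particle (move \<eta> x z) u)) - f (add_particle \<eta> u))"
  have "gen f (add_particle \<eta> u) = (\<Sum>x\<in>?F. ?t x + (if x = u then ?D else 0))"
    unfolding gen_eq_sum[OF fin, of "add_particle \<eta> u", unfolded support_add_particle, OF order_refl]
  proof (intro sum.cong refl)
    fix x assume x: "x \<in> ?F"
    show "g (add_particle \<eta> u x) * (measure_pmf.expectation (p x)
        (\<lambda>z. f (move (add_particle \<eta> u) x z)) - f (add_particle \<eta> u)) =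
      ?t x + (if x = u then ?D else 0)"
    proof (cases "x = u")
      case False
      hence "x \<in> support \<eta>" using x by simp
      thus ?thesis using False
        by (simp add: move_add_particle_commute) (simp add: add_particle_def)
    next
      case True
      \<comment> \<open>If \<open>u\<close> is vacant in \<open>\<eta>\<close>, the term in question
        has the factor \<open>g 0 = 0\<close>, so the identity is needed only for occupied
        \<open>u\<close>.\<close>
      have eq: "add_particle (move \<eta> u z) u = add_particle \<eta> z" if "\<eta> u \<noteq> 0" for z
        using move_add_particle_commute[of u \<eta> u z] that by (simp add: move_add_particle support_def)
      have "add_particle \<eta> u u = \<eta> u + 1" by (simp add: add_particle_def)
      thus ?thesis
        using True eq g_0 by (cases "\<eta> u = 0") (simp_all add: move_add_particle algebra_simps)
    qed
  qed
  also have "\<dots> = sum ?t ?F + ?D" using fin by (simp add: sum.distrib)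
  also have "sum ?t ?F = gen (\<lambda>\<xi>. f (add_particle \<xi> u)) \<eta>"
    by (intro gen_eq_sum[symmetric] fin) auto
  finally show ?thesis .
qed

lemma sector_bounded_add_particle:
  "sector_bounded f \<Longrightarrow> sector_bounded (\<lambda>\<xi>. f (add_particle \<xi> u))"
  unfolding sector_bounded_def using add_particle_sector by meson

text \<open>The increment \<open>F\<close> is acted on by \<open>L + l\<close> with nonnegative
  weights of sum \<open>l\<close>, so its bound is merely multiplied by \<open>l\<close>; the change
  of rate at \<open>u\<close>, at most \<open>a0\<close> in absolute value, contributes the
  rest.\<close>

lemma shift_add_particle_lipschitz:
  assumes f: "sector_bounded f" and c: "0 \<le> c"
    and lip: "\<And>\<xi> u. \<xi> \<in> sector M \<Longrightarrow> \<bar>f (add_particle \<xi> u) - f \<xi>\<bar> \<le> c * beta p u"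
    and l: "a0 * M \<le> l" and \<eta>: "\<eta> \<in> sector M"
  shows "\<bar>shift l f (add_particle \<eta> u) - shift l f \<eta>\<bar> \<le> (l + 3 * a0) * c * beta p u"
proof -
  define F where "F = (\<lambda>\<xi>. 1 * f (add_particle \<xi> u) + (-1) * f \<xi>)"
  have F: "\<bar>F \<xi>\<bar> \<le> c * beta p u" if "\<xi> \<in> sector M" for \<xi>
    using lip[OF that, of u] by (simp add: F_def)
  have genF: "gen F \<eta> = gen (\<lambda>\<xi>. f (add_particle \<xi> u)) \<eta> - gen f \<eta>"
    unfolding F_def using gen_lin[OF sector_bounded_add_particle[OF f] f \<eta>, where a = 1 and b = "-1"]
    by simp
  let ?D = "measure_pmf.expectation (p u) (\<lambda>z. f (add_particle \<eta> z)) - f (add_particle \<eta> u)"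
  have eq: "shift l f (add_particle \<eta> u) - shift l f \<eta> =
      (gen F \<eta> + l * F \<eta>) + (g (\<eta> u + 1) - g (\<eta> u)) * ?D"
    unfolding shift_def gen_add_particle[OF \<eta>] genF by (simp add: F_def algebra_simps)
  have "\<bar>gen F \<eta> + l * F \<eta>\<bar> \<le> l * (c * beta p u)"
  proof -
    let ?r = "\<Sum>x\<in>support \<eta>. g (\<eta> x)"
    have r: "?r \<le> l" using sum_rate_le[OF \<eta>] l by linarith
    \<comment> \<open>The negative diagonal part of \<open>gen\<close> is absorbed into
      \<open>l\<close>: the weights are the rates \<open>g (\<eta> x)\<close> and the remainder
      \<open>l - ?r\<close>, which is nonnegative by the choice of \<open>l\<close>.\<close>
    have "gen F \<eta> + l * F \<eta> =
        (\<Sum>x\<in>support \<eta>. g (\<eta> x) * measure_pmf.expectation (p x) (\<lambda>z. F (move \<eta> x z))) + (l - ?r) * F \<eta>"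
      unfolding gen_def by (simp add: right_diff_distrib left_diff_distrib sum_subtractf sum_distrib_right)
    also have "\<bar>\<dots>\<bar> \<le> (\<Sum>x\<in>support \<eta>. g (\<eta> x) * (c * beta p u)) + (l - ?r) * (c * beta p u)"
    proof (intro order_trans[OF abs_triangle_ineq] add_mono order_trans[OF sum_abs] sum_mono)
      fix x assume x: "x \<in> support \<eta>"
      show "\<bar>g (\<eta> x) * measure_pmf.expectation (p x) (\<lambda>z. F (move \<eta> x z))\<bar> \<le> g (\<eta> x) * (c * beta p u)"
        unfolding abs_mult abs_of_nonneg[OF g_nonneg]
        by (intro mult_left_mono g_nonneg abs_expectation_pmf_le F move_sector[OF \<eta> x])
    next
      show "\<bar>(l - ?r) * F \<eta>\<bar> \<le> (l - ?r) * (c * beta p u)"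
        unfolding abs_mult using r by (intro mult_mono F[OF \<eta>]) auto
    qed
    also have "\<dots> = l * (c * beta p u)" by (simp add: sum_distrib_right[symmetric] left_diff_distrib)
    finally show ?thesis .
  qed
  \<comment> \<open>The two configurations in \<open>?D\<close> are compared through their common
    part \<open>\<eta>\<close>: going up to \<open>z\<close> costs \<open>2 * beta p u\<close> on
    average, going up to \<open>u\<close> costs \<open>beta p u\<close>.\<close>
  moreover have "\<bar>(g (\<eta> u + 1) - g (\<eta> u)) * ?D\<bar> \<le> a0 * (3 * c * beta p u)"
  proof -
    obtain B where B: "\<And>\<xi>. \<xi> \<in> sector (Suc M) \<Longrightarrow> \<bar>f \<xi>\<bar> \<le> B" using sector_boundedE[OF f] by blast
    have int: "integrable (measure_pmf (p u)) (\<lambda>z. f (add_particle \<eta> z))"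
      by (rule integrable_pmf_bounded[where B = B]) (intro B add_particle_sector[OF \<eta>])
    have "?D = measure_pmf.expectation (p u) (\<lambda>z. f (add_particle \<eta> z) - f (add_particle \<eta> u))"
      using int by simp
    also have "\<bar>\<dots>\<bar> \<le> measure_pmf.expectation (p u) (\<lambda>z. \<bar>f (add_particle \<eta> z) - f (add_particle \<eta> u)\<bar>)"
      by (rule integral_abs_bound)
    also have "\<dots> \<le> measure_pmf.expectation (p u) (\<lambda>z. c * beta p z + c * beta p u)"
    proof (rule integral_mono)
      show "\<bar>f (add_particle \<eta> z) - f (add_particle \<eta> u)\<bar> \<le> c * beta p z + c * beta p u" for z
        using lip[OF \<eta>, of z] lip[OF \<eta>, of u] by linarith
      show "integrable (measure_pmf (p u)) (\<lambda>z. c * beta p z + c * beta p u)"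
      proof (rule integrable_pmf_bounded)
        fix y
        have "0 \<le> c * beta p y" "0 \<le> c * beta p u" "c * beta p y \<le> c * 2"
          using c by (simp_all add: beta_nonneg mult_left_mono beta_le_2)
        thus "\<bar>c * beta p y + c * beta p u\<bar> \<le> c * 2 + c * beta p u" by linarith
      qed
    qed (use int in auto)
    also have "\<dots> = c * measure_pmf.expectation (p u) (beta p) + c * beta p u"
      using integrable_beta[of "p u" p] by simp
    also have "\<dots> \<le> c * (2 * beta p u) + c * beta p u"
      by (intro add_right_mono mult_left_mono expectation_beta_le c)
    finally have "\<bar>?D\<bar> \<le> 3 * c * beta p u" by simp
    thus ?thesis unfolding abs_mult by (intro mult_mono g_lip a0_nonneg) auto
  qed
  ultimately show ?thesis unfolding eq by (simp add: algebra_simps)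
qed

lemma heat_lipschitz:
  assumes f: "sector_bounded f" and c: "0 \<le> c" and t: "0 \<le> t"
    and lip: "\<And>\<xi> u. \<xi> \<in> finite_configs \<Longrightarrow> \<bar>f (add_particle \<xi> u) - f \<xi>\<bar> \<le> c * beta p u"
    and \<eta>: "\<eta> \<in> finite_configs" and \<zeta>: "\<zeta> \<in> finite_configs"
  shows "\<bar>heat k t f \<eta> - heat k t f \<zeta>\<bar> \<le> c * exp (3 * a0 * t) * cdist p \<eta> \<zeta>"
proof -
  obtain M M' where M: "\<eta> \<in> sector M" "\<zeta> \<in> sector M'"
    using \<eta> \<zeta> by (auto simp: finite_configs_eq_sector)
  define N where "N = max M M'"
  \<comment> \<open>Joining \<open>\<eta>\<close> and \<open>\<zeta>\<close> by single removals only
    meets sectors \<open>K < N\<close>, so this one value dominates all total rates along the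
    path.\<close>
  define l where "l = a0 * N"
  have l: "0 \<le> l + 3 * a0" using a0_nonneg by (simp add: l_def)
  have pow: "\<bar>(shift l ^^ n) f (add_particle \<xi> u) - (shift l ^^ n) f \<xi>\<bar>
      \<le> (l + 3 * a0) ^ n * c * beta p u" if "K < N" "\<xi> \<in> sector K" for n \<xi> u K
    using that(2)
  proof (induction n arbitrary: \<xi> u)
    case 0
    thus ?case using lip sector_finite_configs by fastforce
  next
    case (Suc n)
    have "\<bar>shift l ((shift l ^^ n) f) (add_particle \<xi> u) - shift l ((shift l ^^ n) f) \<xi>\<bar>
        \<le> (l + 3 * a0) * ((l + 3 * a0) ^ n * c) * beta p u"
    proof (rule shift_add_particle_lipschitz[OF _ _ _ _ Suc.prems])
      show "a0 * K \<le> l" unfolding l_def using that by (intro mult_left_mono a0_nonneg) auto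
    qed (use Suc.IH f c l in \<open>auto intro: sector_bounded_shift_pow\<close>)
    thus ?case by (simp add: mult.assoc)
  qed
  have "\<bar>heat l t f (add_particle \<xi> u) - heat l t f \<xi>\<bar> \<le> c * exp (3 * a0 * t) * beta p u"
    if K: "K < N" and \<xi>: "\<xi> \<in> sector K" for K \<xi> u
  proof -
    let ?b = "\<lambda>n. c * beta p u * (((l + 3 * a0) * t) ^ n / fact n)"
    have b: "?b sums (c * beta p u * exp ((l + 3 * a0) * t))" by (rule exp_series)
    let ?d = "\<lambda>n. (shift l ^^ n) f (add_particle \<xi> u) / fact n * t ^ n - (shift l ^^ n) f \<xi> / fact n * t ^ n"
    have "exp_shift l t f (add_particle \<xi> u) - exp_shift l t f \<xi> = suminf ?d"
      unfolding exp_shift_def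
      by (rule suminf_diff[OF summable_exp_shift[OF f add_particle_sector[OF \<xi>]] summable_exp_shift[OF f \<xi>]])
    moreover have "norm (suminf ?d) \<le> suminf ?b"
    proof (rule norm_suminf_le[OF _ sums_summable[OF b]])
      fix n
      have "?d n = ((shift l ^^ n) f (add_particle \<xi> u) - (shift l ^^ n) f \<xi>) * (t ^ n / fact n)"
        by (simp add: algebra_simps diff_divide_distrib)
      also have "norm \<dots> = \<bar>(shift l ^^ n) f (add_particle \<xi> u) - (shift l ^^ n) f \<xi>\<bar> * (t ^ n / fact n)"
        using t by (simp add: abs_mult)
      also have "\<dots> \<le> (l + 3 * a0) ^ n * c * beta p u * (t ^ n / fact n)"
        using t by (intro mult_right_mono pow[OF K \<xi>]) auto
      finally show "norm (?d n) \<le> ?b n" by (simp add: power_mult_distrib mult_ac)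
    qed
    ultimately have "\<bar>exp_shift l t f (add_particle \<xi> u) - exp_shift l t f \<xi>\<bar>
        \<le> c * beta p u * exp ((l + 3 * a0) * t)"
      using sums_unique[OF b] by simp
    hence "exp (- l * t) * \<bar>exp_shift l t f (add_particle \<xi> u) - exp_shift l t f \<xi>\<bar>
        \<le> exp (- l * t) * (c * beta p u * exp ((l + 3 * a0) * t))"
      by (intro mult_left_mono) auto
    also have "\<dots> = c * beta p u * (exp (- l * t) * exp ((l + 3 * a0) * t))" by simp
    \<comment> \<open>Here \<open>l\<close>, and with it the dependence on the number of particles,
      disappears.\<close>
    also have "exp (- l * t) * exp ((l + 3 * a0) * t) = exp (3 * a0 * t)"
      by (simp add: algebra_simps flip: exp_add)
    finally show ?thesis
      by (simp add: heat_def abs_mult mult_ac flip: right_diff_distrib)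
  qed
  from lipschitz_of_add_particle[of N, OF this M(1) _ M(2)]
  have "\<bar>heat l t f \<eta> - heat l t f \<zeta>\<bar> \<le> c * exp (3 * a0 * t) * cdist p \<eta> \<zeta>"
    by (simp add: N_def)
  thus ?thesis
    using heat_indep[OF f M(1) t, where k = k and l = l] heat_indep[OF f M(2) t, where k = k and l = l]
    by simp
qed

end

section \<open>The configuration space \<open>\<Omega>'\<close>\<close>

lemma integrable_count_space_iff_summable:
  fixes f :: "'a \<Rightarrow> real"
  shows "integrable (count_space A) f \<longleftrightarrow> f summable_on A"
  using abs_summable_equivalent[of f A] summable_on_iff_abs_summable_on_real[of f A]
  by (simp add: Infinite_Set_Sum.abs_summable_on_def)

lemma infsum_eq_integral:
  fixes f :: "'a \<Rightarrow> real"
  assumes "integrable (count_space A) f"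
  shows "infsum f A = integral\<^sup>L (count_space A) f"
  using infsetsum_infsum[of f A] assms
  by (simp add: infsetsum_def Infinite_Set_Sum.abs_summable_on_def)

lemma infsum_tendsto_dominated:
  fixes f :: "nat \<Rightarrow> 'a \<Rightarrow> real"
  assumes w: "w summable_on A" and f: "\<And>n x. x \<in> A \<Longrightarrow> \<bar>f n x\<bar> \<le> w x"
    and lim: "\<And>x. x \<in> A \<Longrightarrow> (\<lambda>n. f n x) \<longlonglongrightarrow> h x"
  shows "(\<lambda>n. infsum (f n) A) \<longlonglongrightarrow> infsum h A"
proof -
  let ?M = "count_space A"
  have w': "integrable ?M w" using w by (simp add: integrable_count_space_iff_summable)
  have AE: "AE x in ?M. (\<lambda>n. f n x) \<longlonglongrightarrow> h x" "AE x in ?M. norm (f n x) \<le> w x" for n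
    using f lim by (simp_all add: AE_count_space)
  have "integrable ?M h" "integrable ?M (f n)" for n
    by (rule integrable_dominated_convergence[OF _ _ w' AE]
          integrable_dominated_convergence2[OF _ _ w' AE]; simp)+
  moreover have "(\<lambda>n. integral\<^sup>L ?M (f n)) \<longlonglongrightarrow> integral\<^sup>L ?M h"
    by (rule integral_dominated_convergence[OF _ _ w' AE]) simp_all
  ultimately show ?thesis by (simp add: infsum_eq_integral)
qed

lemma infsum_pmf_mult:
  fixes f :: "'a \<Rightarrow> real"
  assumes "integrable (measure_pmf M) f"
  shows "(\<lambda>x. pmf M x * f x) summable_on UNIV"
    and "(\<Sum>\<^sub>\<infinity>x. pmf M x * f x) = measure_pmf.expectation M f"
proof -
  have int: "integrable (count_space UNIV) (\<lambda>x. pmf M x * f x)"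
    using assms by (simp add: measure_pmf_eq_density integrable_density)
  show "(\<lambda>x. pmf M x * f x) summable_on UNIV" using int by (simp add: integrable_count_space_iff_summable)
  show "(\<Sum>\<^sub>\<infinity>x. pmf M x * f x) = measure_pmf.expectation M f"
    unfolding infsum_eq_integral[OF int] by (simp add: measure_pmf_eq_density integral_density)
qed

section \<open>The weighted distance on \<open>\<Omega>'\<close> and its approximation by finite
  configurations\<close>

lemma Omega'_iff: "\<eta> \<in> Omega' p \<longleftrightarrow> (\<lambda>x. real (\<eta> x) * beta p x) summable_on UNIV"
  by (simp add: Omega'_def)

lemma cdist_summable:
  assumes "\<eta> \<in> Omega' p" "\<zeta> \<in> Omega' p"
  shows "(\<lambda>x. \<bar>real (\<eta> x) - real (\<zeta> x)\<bar> * beta p x) summable_on UNIV"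
proof (rule summable_on_comparison_test)
  show "(\<lambda>x. real (\<eta> x) * beta p x + real (\<zeta> x) * beta p x) summable_on UNIV"
    using assms by (intro summable_on_add) (simp_all add: Omega'_iff)
  show "\<bar>real (\<eta> x) - real (\<zeta> x)\<bar> * beta p x \<le> real (\<eta> x) * beta p x + real (\<zeta> x) * beta p x" for x
    unfolding distrib_right[symmetric] by (intro mult_right_mono beta_nonneg) auto
qed (simp add: beta_nonneg)

lemma cdist_nonneg: "0 \<le> cdist p \<eta> \<zeta>"
  unfolding cdist_def by (intro infsum_nonneg) (simp add: beta_nonneg)

lemma cdist_triangle:
  assumes "\<eta> \<in> Omega' p" "\<zeta> \<in> Omega' p" "\<xi> \<in> Omega' p"
  shows "cdist p \<eta> \<zeta> \<le> cdist p \<eta> \<xi> + cdist p \<xi> \<zeta>"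
proof -
  have "cdist p \<eta> \<zeta> \<le> (\<Sum>\<^sub>\<infinity>x. \<bar>real (\<eta> x) - real (\<xi> x)\<bar> * beta p x + \<bar>real (\<xi> x) - real (\<zeta> x)\<bar> * beta p x)"
    unfolding cdist_def
  proof (intro infsum_mono summable_on_add cdist_summable assms)
    fix x
    show "\<bar>real (\<eta> x) - real (\<zeta> x)\<bar> * beta p x \<le>
        \<bar>real (\<eta> x) - real (\<xi> x)\<bar> * beta p x + \<bar>real (\<xi> x) - real (\<zeta> x)\<bar> * beta p x"
      unfolding distrib_right[symmetric] by (intro mult_right_mono beta_nonneg) auto
  qed
  also have "\<dots> = cdist p \<eta> \<xi> + cdist p \<xi> \<zeta>"
    unfolding cdist_def by (intro infsum_add cdist_summable assms)
  finally show ?thesis .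
qed

lemma finite_configs_subset_Omega': "finite_configs \<subseteq> Omega' p"
  by (auto simp: finite_configs_eq Omega'_iff support_def intro!: finite_nonzero_values_imp_summable_on
      elim: finite_subset[rotated])

lemma add_particle_Omega'_iff: "add_particle \<eta> u \<in> Omega' p \<longleftrightarrow> \<eta> \<in> Omega' p"
proof -
  have sgl: "(\<lambda>x. if x = u then beta p u else 0) summable_on UNIV"
    by (intro finite_nonzero_values_imp_summable_on) (auto intro: finite_subset[of _ "{u}"])
  have eq: "real (add_particle \<eta> u x) * beta p x = real (\<eta> x) * beta p x + (if x = u then beta p u else 0)" for x
    by (simp add: add_particle_def algebra_simps)
  show ?thesis
  proof
    assume "\<eta> \<in> Omega' p"
    thus "add_particle \<eta> u \<in> Omega' p"
      unfolding Omega'_iff eq by (intro summable_on_add sgl)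
  next
    assume "add_particle \<eta> u \<in> Omega' p"
    thus "\<eta> \<in> Omega' p"
      unfolding Omega'_iff by (rule summable_on_comparison_test) (auto simp: eq beta_nonneg)
  qed
qed

text \<open>The triangle inequality through the configuration without the moving particle, which
  lies at distance \<open>beta p x\<close> from one end and \<open>beta p z\<close> from the
  other.\<close>

lemma move_Omega':
  assumes "\<eta> \<in> Omega' p" "x \<in> support \<eta>"
  shows "move \<eta> x z \<in> Omega' p" "cdist p (move \<eta> x z) \<eta> \<le> beta p z + beta p x"
proof -
  obtain \<xi> where \<xi>: "\<eta> = add_particle \<xi> x" using obtain_add_particle assms(2) .
  have \<xi>': "\<xi> \<in> Omega' p" using assms(1) by (simp add: \<xi> add_particle_Omega'_iff)
  thus "move \<eta> x z \<in> Omega' p" by (simp add: \<xi> move_add_particle add_particle_Omega'_iff)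
  have "cdist p (add_particle \<xi> z) (add_particle \<xi> x) \<le> beta p z + beta p x"
    using cdist_triangle[of "add_particle \<xi> z" p "add_particle \<xi> x" \<xi>] \<xi>'
    by (simp add: add_particle_Omega'_iff cdist_add_particle cdist_commute[of p \<xi>])
  thus "cdist p (move \<eta> x z) \<eta> \<le> beta p z + beta p x" by (simp add: \<xi> move_add_particle)
qed

text \<open>Keeps a configuration on the first \<open>n\<close> sites of an enumeration of the
  lattice. Acting site by site, it does not increase distances, and it fixes every finite
  configuration for large \<open>n\<close>.\<close>

definition truncate :: "nat \<Rightarrow> ('a::countable \<Rightarrow> nat) \<Rightarrow> 'a \<Rightarrow> nat" where
  "truncate n \<eta> x = (if to_nat x < n then \<eta> x else 0)"

lemma finite_to_nat_less: "finite {x::'a::countable. to_nat x < n}"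
  using finite_vimageI[OF finite_lessThan inj_to_nat, of n] by (simp add: vimage_def lessThan_def)

lemma truncate_finite_configs: "truncate n \<eta> \<in> finite_configs"
  by (auto simp: finite_configs_eq support_def truncate_def intro: finite_subset[OF _ finite_to_nat_less[of n]])

lemma truncate_Omega': "truncate n \<eta> \<in> Omega' p"
  using truncate_finite_configs finite_configs_subset_Omega' by blast

lemma truncate_eventually_eq:
  assumes "\<eta> \<in> finite_configs"
  shows "eventually (\<lambda>n. truncate n \<eta> = \<eta>) sequentially"
proof -
  have "eventually (\<lambda>n. \<forall>x\<in>support \<eta>. to_nat x < n) sequentially"
    using assms by (intro eventually_ball_finite ballI eventually_gt_at_top)
      (simp add: finite_configs_eq)
  thus ?thesis by eventually_elim (auto simp: truncate_def support_def fun_eq_iff)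
qed

lemma cdist_truncate_le:
  assumes "\<eta> \<in> Omega' p" "\<zeta> \<in> Omega' p"
  shows "cdist p (truncate n \<eta>) (truncate n \<zeta>) \<le> cdist p \<eta> \<zeta>"
  unfolding cdist_def
  by (intro infsum_mono cdist_summable truncate_Omega' assms) (simp add: truncate_def beta_nonneg)

lemma cdist_truncate_tendsto:
  assumes "\<eta> \<in> Omega' p"
  shows "(\<lambda>n. cdist p (truncate n \<eta>) \<eta>) \<longlonglongrightarrow> 0"
proof -
  have "(\<lambda>n. cdist p (truncate n \<eta>) \<eta>) \<longlonglongrightarrow> (\<Sum>\<^sub>\<infinity>x::'a site. 0)"
    unfolding cdist_def
  proof (rule infsum_tendsto_dominated)
    show "(\<lambda>x. real (\<eta> x) * beta p x) summable_on UNIV" using assms by (simp add: Omega'_iff)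
    fix x
    show "\<bar>\<bar>real (truncate n \<eta> x) - real (\<eta> x)\<bar> * beta p x\<bar> \<le> real (\<eta> x) * beta p x" for n
      by (simp add: truncate_def beta_nonneg)
    have "eventually (\<lambda>n. \<bar>real (truncate n \<eta> x) - real (\<eta> x)\<bar> * beta p x = 0) sequentially"
      using eventually_gt_at_top[of "to_nat x"] by eventually_elim (simp add: truncate_def)
    thus "(\<lambda>n. \<bar>real (truncate n \<eta> x) - real (\<eta> x)\<bar> * beta p x) \<longlonglongrightarrow> 0"
      by (rule tendsto_eventually)
  qed
  thus ?thesis by simp
qed

section \<open>Lipschitz functions and their least constants\<close>

lemma lipschitz_boundD:
  assumes "lipschitz_bound p f c" "\<eta> \<in> Omega' p" "\<zeta> \<in> Omega' p"
  shows "\<bar>f \<eta> - f \<zeta>\<bar> \<le> c * cdist p \<eta> \<zeta>"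
  using assms by (simp add: lipschitz_bound_def)

text \<open>Comparing the empty configuration with one particle at the origin.\<close>

lemma lipschitz_bound_nonneg:
  assumes "lipschitz_bound p f c"
  shows "0 \<le> c"
proof -
  let ?\<zeta> = "(\<lambda>_. 0) :: 'a config"
  have \<zeta>: "?\<zeta> \<in> Omega' p" by (simp add: Omega'_iff)
  have "0 \<le> c * beta p 0"
    using lipschitz_boundD[OF assms, of "add_particle ?\<zeta> 0" ?\<zeta>] \<zeta>
    by (simp add: add_particle_Omega'_iff cdist_add_particle)
  thus ?thesis using beta_0_ge_1[of p] by (simp add: zero_le_mult_iff)
qed

text \<open>The admissible constants form a closed set, an intersection of closed conditions on
  \<open>c\<close>, bounded below by 0. Hence the infimum is attained and the \<open>LEAST\<close>
  in the definition is meaningful.\<close>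

lemma lip_const:
  assumes "f \<in> Lip p"
  shows "lipschitz_bound p f (lip_const p f)" and "lipschitz_bound p f c \<Longrightarrow> lip_const p f \<le> c"
proof -
  let ?S = "{c. lipschitz_bound p f c}"
  have ne: "?S \<noteq> {}" using assms by (auto simp: Lip_def)
  have bdd: "bdd_below ?S" using lipschitz_bound_nonneg by (auto intro!: bdd_belowI)
  have "?S = (\<Inter>\<eta>\<in>Omega' p. \<Inter>\<zeta>\<in>Omega' p. {c. \<bar>f \<eta> - f \<zeta>\<bar> \<le> c * cdist p \<eta> \<zeta>})"
    by (auto simp: lipschitz_bound_def)
  moreover have "closed \<dots>"
    by (intro closed_INT ballI closed_Collect_le continuous_intros)
  ultimately have "closed ?S" by simp
  hence Inf: "lipschitz_bound p f (Inf ?S)"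
    using closed_contains_Inf[OF ne bdd] by simp
  have "lip_const p f = Inf ?S"
    unfolding lip_const_def using Inf by (intro Least_equality cInf_lower[OF _ bdd]) auto
  thus "lipschitz_bound p f (lip_const p f)" "lipschitz_bound p f c \<Longrightarrow> lip_const p f \<le> c"
    using Inf cInf_lower[OF _ bdd] by auto
qed

text \<open>Since \<open>beta\<close> is at most 2, a configuration of \<open>N\<close> particles
  lies within distance \<open>2 * N\<close> of the empty one.\<close>

lemma lipschitz_sector_bounded:
  assumes f: "lipschitz_bound p f c"
  shows "sector_bounded f"
proof (rule sector_boundedI)
  fix N and \<eta> :: "'a config" assume \<eta>: "\<eta> \<in> sector N"
  let ?\<zeta> = "(\<lambda>_. 0) :: 'a config"
  have "cdist p \<eta> ?\<zeta> = (\<Sum>x\<in>support \<eta>. real (\<eta> x) * beta p x)"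
    using \<eta> by (subst cdist_finite[of "support \<eta>"]) (auto simp: sector_def support_def)
  also have "\<dots> \<le> (\<Sum>x\<in>support \<eta>. real (\<eta> x) * 2)"
    by (intro sum_mono mult_left_mono beta_le_2) auto
  also have "\<dots> = 2 * real N" using \<eta> by (simp add: sector_def flip: sum_distrib_right of_nat_sum)
  finally have "c * cdist p \<eta> ?\<zeta> \<le> c * (2 * real N)"
    by (intro mult_left_mono lipschitz_bound_nonneg[OF f])
  moreover have "\<bar>f \<eta> - f ?\<zeta>\<bar> \<le> c * cdist p \<eta> ?\<zeta>"
    using subsetD[OF finite_configs_subset_Omega' sector_finite_configs[OF \<eta>]]
    by (intro lipschitz_boundD[OF f]) (simp_all add: Omega'_iff)
  ultimately show "\<bar>f \<eta>\<bar> \<le> \<bar>f ?\<zeta>\<bar> + c * (2 * real N)" by linarith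
qed

lemma Lip_sector_bounded: "f \<in> Lip p \<Longrightarrow> sector_bounded f"
  using lipschitz_sector_bounded by (auto simp: Lip_def)

section \<open>Extension of the semigroup to \<open>\<Omega>'\<close>\<close>

context zero_range
begin

text \<open>The contribution of one source site. The difference stays inside the expectation because
  over infinitely many sites only increments of \<open>f\<close>, not its values, are controlled by
  the weights.\<close>

definition jump_diff :: "('d config \<Rightarrow> real) \<Rightarrow> 'd config \<Rightarrow> 'd site \<Rightarrow> real" where
  "jump_diff f \<eta> x = g (\<eta> x) * measure_pmf.expectation (p x) (\<lambda>z. f (move \<eta> x z) - f \<eta>)"

text \<open>\<open>zr_gen\<close> sums over sources and displacements. Reindexing each row by the
  target makes it an expectation, and the second hypothesis, on the row sums of absolute values,
  justifies summing by rows.\<close>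

lemma zr_gen_eq_infsum:
  assumes int: "\<And>x. x \<in> support \<eta> \<Longrightarrow> integrable (measure_pmf (p x)) (\<lambda>z. f (move \<eta> x z))"
    and summ: "(\<lambda>x. g (\<eta> x) * measure_pmf.expectation (p x) (\<lambda>z. \<bar>f (move \<eta> x z) - f \<eta>\<bar>)) summable_on UNIV"
  shows "zr_gen p g f \<eta> = infsum (jump_diff f \<eta>) UNIV"
proof -
  let ?k = "\<lambda>x z. g (\<eta> x) * (f (move \<eta> x z) - f \<eta>)"
  let ?\<phi> = "\<lambda>x y. pmf (p x) (x + y) * ?k x (x + y)"
  \<comment> \<open>At vacant sites \<open>g 0 = 0\<close> makes \<open>?k\<close> vanish, whatever
    \<open>f\<close> does on the meaningless moves from there.\<close>
  have int': "integrable (measure_pmf (p x)) (?k x)" for x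
    by (cases "x \<in> support \<eta>") (use int[of x] in \<open>auto simp: support_def g_0\<close>)
  have bij: "bij ((+) x)" for x :: "'d site" 
    by (rule bij_betw_byWitness[where f' = "\<lambda>y. y - x"]) auto
  have in1: "(\<lambda>y. ?\<phi> x y) summable_on UNIV" "(\<Sum>\<^sub>\<infinity>y. ?\<phi> x y) = jump_diff f \<eta> x" for x
    using summable_on_reindex_bij_betw[OF bij[of x], of "\<lambda>z. pmf (p x) z * ?k x z"]
      infsum_reindex_bij_betw[OF bij[of x], of "\<lambda>z. pmf (p x) z * ?k x z"]
      infsum_pmf_mult[OF int'[of x]] by (simp_all add: jump_diff_def)
  have in2: "(\<lambda>y. norm (?\<phi> x y)) summable_on UNIV"
    "(\<Sum>\<^sub>\<infinity>y. norm (?\<phi> x y)) = g (\<eta> x) * measure_pmf.expectation (p x) (\<lambda>z. \<bar>f (move \<eta> x z) - f \<eta>\<bar>)" for x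
    using summable_on_reindex_bij_betw[OF bij[of x], of "\<lambda>z. pmf (p x) z * \<bar>?k x z\<bar>"]
      infsum_reindex_bij_betw[OF bij[of x], of "\<lambda>z. pmf (p x) z * \<bar>?k x z\<bar>"]
      infsum_pmf_mult[OF integrable_abs[OF int'[of x]]] by (simp_all add: abs_mult g_nonneg)
  have "(\<lambda>z. norm (case_prod ?\<phi> z)) summable_on (SIGMA x:UNIV. UNIV)"
    unfolding Infinite_Sum.abs_summable_on_Sigma_iff split in2(2)
    by (intro conjI ballI in2(1), subst summable_on_iff_abs_summable_on_real[symmetric], rule summ)
  hence "case_prod ?\<phi> summable_on (SIGMA x:UNIV. UNIV)" by (rule abs_summable_summable)
  from infsum_Sigma'_banach[OF this] show ?thesis
    unfolding zr_gen_def in1 by (simp add: mult.assoc UNIV_Times_UNIV)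
qed

lemma zr_gen_finite:
  assumes f: "sector_bounded f" and \<eta>: "\<eta> \<in> sector N"
  shows "zr_gen p g f \<eta> = gen f \<eta>"
proof -
  have fin: "finite (support \<eta>)" using \<eta> by (simp add: sector_def)
  have "zr_gen p g f \<eta> = infsum (jump_diff f \<eta>) UNIV"
    by (intro zr_gen_eq_infsum integrable_move[OF f \<eta>] finite_nonzero_values_imp_summable_on
        finite_subset[OF _ fin]) (auto simp: support_def g_0 intro: ccontr)
  also have "\<dots> = infsum (jump_diff f \<eta>) (support \<eta>)"
    by (intro infsum_cong_neutral) (auto simp: jump_diff_def support_def g_0)
  also have "\<dots> = gen f \<eta>"
    using integrable_move[OF f \<eta>] fin by (simp add: jump_diff_def gen_def)
  finally show ?thesis .
qed

lemma integrable_move_Lip: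
  assumes f: "lipschitz_bound p f c" and \<eta>: "\<eta> \<in> Omega' p" and x: "x \<in> support \<eta>"
  shows "integrable (measure_pmf (p x)) (\<lambda>z. f (move \<eta> x z))"
    and "\<bar>f (move \<eta> x z) - f \<eta>\<bar> \<le> c * (beta p z + beta p x)"
proof -
  note c = lipschitz_bound_nonneg[OF f]
  show *: "\<bar>f (move \<eta> x z) - f \<eta>\<bar> \<le> c * (beta p z + beta p x)" for z
    using lipschitz_boundD[OF f move_Omega'(1)[OF \<eta> x] \<eta>, of z]
      mult_left_mono[OF move_Omega'(2)[OF \<eta> x, of z] c] by linarith
  show "integrable (measure_pmf (p x)) (\<lambda>z. f (move \<eta> x z))"
  proof (rule integrable_pmf_bounded)
    fix z
    have "c * (beta p z + beta p x) \<le> c * (2 + 2)"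
      by (intro mult_left_mono add_mono beta_le_2 c)
    thus "\<bar>f (move \<eta> x z)\<bar> \<le> \<bar>f \<eta>\<bar> + c * (2 + 2)" using *[of z] by linarith
  qed
qed

text \<open>The rate is at most \<open>a0 * \<eta> x\<close>, and a jump costs at most
  \<open>c * (2 + 1) * beta p x\<close> on average. Membership in \<open>\<Omega>'\<close> makes
  these bounds summable, so they serve both for absolute convergence and as a dominating
  family.\<close>

lemma expectation_jump_le:
  assumes f: "lipschitz_bound p f c" and \<eta>: "\<eta> \<in> Omega' p"
  shows "g (\<eta> x) * measure_pmf.expectation (p x) (\<lambda>z. \<bar>f (move \<eta> x z) - f \<eta>\<bar>)
    \<le> 3 * a0 * c * (real (\<eta> x) * beta p x)"
proof (cases "x \<in> support \<eta>")
  case False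
  thus ?thesis by (simp add: support_def g_0)
next
  case True
  note c = lipschitz_bound_nonneg[OF f]
  have "measure_pmf.expectation (p x) (\<lambda>z. \<bar>f (move \<eta> x z) - f \<eta>\<bar>)
      \<le> measure_pmf.expectation (p x) (\<lambda>z. c * (beta p z + beta p x))"
    using integrable_move_Lip[OF f \<eta> True] integrable_beta[of "p x" p] by (intro integral_mono) auto
  also have "\<dots> = c * (measure_pmf.expectation (p x) (beta p) + beta p x)"
    using integrable_beta[of "p x" p] by simp
  also have "\<dots> \<le> c * (2 * beta p x + beta p x)"
    by (intro mult_left_mono add_right_mono expectation_beta_le c)
  finally have "g (\<eta> x) * measure_pmf.expectation (p x) (\<lambda>z. \<bar>f (move \<eta> x z) - f \<eta>\<bar>)
      \<le> (a0 * real (\<eta> x)) * (c * (2 * beta p x + beta p x))"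
    using a0_nonneg by (intro mult_mono g_le) (auto intro!: Bochner_Integration.integral_nonneg)
  thus ?thesis by (simp add: algebra_simps)
qed

lemma jump_diff_bound:
  assumes f: "lipschitz_bound p f c" and \<eta>: "\<eta> \<in> Omega' p"
  shows "\<bar>jump_diff f \<eta> x\<bar> \<le> 3 * a0 * c * (real (\<eta> x) * beta p x)"
proof -
  have "\<bar>jump_diff f \<eta> x\<bar> \<le> g (\<eta> x) * measure_pmf.expectation (p x) (\<lambda>z. \<bar>f (move \<eta> x z) - f \<eta>\<bar>)"
    unfolding jump_diff_def abs_mult abs_of_nonneg[OF g_nonneg]
    by (intro mult_left_mono integral_abs_bound g_nonneg)
  thus ?thesis using expectation_jump_le[OF f \<eta>, of x] by linarith
qed

lemma summable_jump:
  assumes "\<eta> \<in> Omega' p"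
  shows "(\<lambda>x. C * (real (\<eta> x) * beta p x)) summable_on UNIV"
  using assms by (intro summable_on_cmult_right) (simp add: Omega'_iff)

lemma zr_gen_Lip:
  assumes f: "lipschitz_bound p f c" and \<eta>: "\<eta> \<in> Omega' p"
  shows "zr_gen p g f \<eta> = infsum (jump_diff f \<eta>) UNIV"
proof (rule zr_gen_eq_infsum)
  show "(\<lambda>x. g (\<eta> x) * measure_pmf.expectation (p x) (\<lambda>z. \<bar>f (move \<eta> x z) - f \<eta>\<bar>)) summable_on UNIV"
    using summable_jump[OF \<eta>]
    by (rule summable_on_comparison_test)
      (auto intro!: expectation_jump_le[OF f \<eta>] mult_nonneg_nonneg g_nonneg Bochner_Integration.integral_nonneg)
qed (rule integrable_move_Lip[OF f \<eta>])

lemma zr_gen_bound: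
  assumes f: "lipschitz_bound p f c" and \<eta>: "\<eta> \<in> Omega' p"
  shows "\<bar>zr_gen p g f \<eta>\<bar> \<le> 3 * a0 * c * (\<Sum>\<^sub>\<infinity>x. real (\<eta> x) * beta p x)"
proof -
  have "norm (infsum (jump_diff f \<eta>) UNIV) \<le> (\<Sum>\<^sub>\<infinity>x. 3 * a0 * c * (real (\<eta> x) * beta p x))"
  proof (rule norm_infsum_le)
    have "(\<lambda>x. \<bar>jump_diff f \<eta> x\<bar>) summable_on UNIV"
      using summable_jump[OF \<eta>] by (rule summable_on_comparison_test) (use jump_diff_bound[OF f \<eta>] in auto)
    hence "jump_diff f \<eta> summable_on UNIV" by (subst summable_on_iff_abs_summable_on_real) simp
    thus "(jump_diff f \<eta> has_sum infsum (jump_diff f \<eta>) UNIV) UNIV" by (rule has_sum_infsum)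
    show "((\<lambda>x. 3 * a0 * c * (real (\<eta> x) * beta p x)) has_sum
        (\<Sum>\<^sub>\<infinity>x. 3 * a0 * c * (real (\<eta> x) * beta p x))) UNIV"
      by (intro has_sum_infsum summable_jump \<eta>)
  qed (use jump_diff_bound[OF f \<eta>] in auto)
  thus ?thesis using \<eta> by (simp add: zr_gen_Lip[OF f \<eta>] infsum_cmult_right Omega'_iff)
qed

text \<open>As soon as \<open>x\<close> lies in the retained region, the rates at \<open>x\<close>
  coincide, and only the values of \<open>f\<close> at nearby configurations have to be
  compared.\<close>

lemma jump_diff_truncate_tendsto:
  assumes f: "lipschitz_bound p f c" and \<eta>: "\<eta> \<in> Omega' p"
  shows "(\<lambda>n. jump_diff f (truncate n \<eta>) x) \<longlonglongrightarrow> jump_diff f \<eta> x"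
proof (cases "x \<in> support \<eta>")
  case False
  hence "jump_diff f (truncate n \<eta>) x = jump_diff f \<eta> x" for n
    by (simp add: jump_diff_def support_def truncate_def g_0)
  thus ?thesis by simp
next
  case True
  note c = lipschitz_bound_nonneg[OF f]
  let ?d = "\<lambda>n. cdist p (truncate n \<eta>) \<eta>"
  have "eventually (\<lambda>n. norm (jump_diff f (truncate n \<eta>) x - jump_diff f \<eta> x) \<le> g (\<eta> x) * (2 * c * ?d n)) sequentially"
    using eventually_gt_at_top[of "to_nat x"]
  proof eventually_elim
    case (elim n)
    have x: "x \<in> support (truncate n \<eta>)" and cx: "truncate n \<eta> x = \<eta> x"
      using True elim by (auto simp: support_def truncate_def)
    note Om = truncate_Omega'[of n \<eta> p]
    \<comment> \<open>The same jump changes both configurations equally at every site, even when the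
      target lies outside the retained region, so their distance is unaffected.\<close>
    have d: "cdist p (move (truncate n \<eta>) x z) (move \<eta> x z) = ?d n" for z
      unfolding cdist_def using True elim
      by (intro infsum_cong) (auto simp: move_def Let_def truncate_def support_def)
    have "jump_diff f (truncate n \<eta>) x - jump_diff f \<eta> x = g (\<eta> x) *
        measure_pmf.expectation (p x) (\<lambda>z. (f (move (truncate n \<eta>) x z) - f (move \<eta> x z)) - (f (truncate n \<eta>) - f \<eta>))"
      unfolding jump_diff_def cx
      using integrable_move_Lip(1)[OF f Om x] integrable_move_Lip(1)[OF f \<eta> True]
      by (simp add: algebra_simps)
    also have "norm \<dots> \<le> g (\<eta> x) * (2 * c * ?d n)"
      unfolding real_norm_def abs_mult abs_of_nonneg[OF g_nonneg]
    proof (intro mult_left_mono g_nonneg abs_expectation_pmf_le)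
      fix z
      have "\<bar>f (move (truncate n \<eta>) x z) - f (move \<eta> x z)\<bar> \<le> c * ?d n"
        using lipschitz_boundD[OF f move_Omega'(1)[OF Om x, where z = z] move_Omega'(1)[OF \<eta> True, where z = z]]
        by (simp add: d)
      moreover have "\<bar>f (truncate n \<eta>) - f \<eta>\<bar> \<le> c * ?d n" by (rule lipschitz_boundD[OF f Om \<eta>])
      ultimately show "\<bar>f (move (truncate n \<eta>) x z) - f (move \<eta> x z) - (f (truncate n \<eta>) - f \<eta>)\<bar> \<le> 2 * c * ?d n"
        by linarith
    qed
    finally show ?case .
  qed
  moreover have "(\<lambda>n. g (\<eta> x) * (2 * c * ?d n)) \<longlonglongrightarrow> 0"
    by (intro tendsto_mult_right_zero cdist_truncate_tendsto \<eta>)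
  ultimately have "(\<lambda>n. jump_diff f (truncate n \<eta>) x - jump_diff f \<eta> x) \<longlonglongrightarrow> 0"
    by (rule Lim_null_comparison)
  thus ?thesis by (simp add: LIM_zero_iff)
qed

lemma zr_gen_truncate_tendsto:
  assumes f: "lipschitz_bound p f c" and \<eta>: "\<eta> \<in> Omega' p"
  shows "(\<lambda>n. zr_gen p g f (truncate n \<eta>)) \<longlonglongrightarrow> zr_gen p g f \<eta>"
  unfolding zr_gen_Lip[OF f \<eta>] zr_gen_Lip[OF f truncate_Omega']
proof (rule infsum_tendsto_dominated[OF summable_jump[OF \<eta>]])
  fix n x
  have "3 * a0 * c * (real (truncate n \<eta> x) * beta p x) \<le> 3 * a0 * c * (real (\<eta> x) * beta p x)"
    using a0_nonneg lipschitz_bound_nonneg[OF f]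
    by (intro mult_left_mono mult_right_mono beta_nonneg) (auto simp: truncate_def)
  thus "\<bar>jump_diff f (truncate n \<eta>) x\<bar> \<le> 3 * a0 * c * (real (\<eta> x) * beta p x)"
    using jump_diff_bound[OF f truncate_Omega', of n \<eta> x] by linarith
qed (rule jump_diff_truncate_tendsto[OF f \<eta>])

section \<open>Locality and linearity of \<open>heat\<close>\<close>

lemma shift_pow_Suc: "(shift l ^^ Suc n) f \<eta> = gen ((shift l ^^ n) f) \<eta> + l * (shift l ^^ n) f \<eta>"
  by (simp add: shift_def)

lemma shift_pow_cong:
  assumes "\<And>\<xi>. \<xi> \<in> sector N \<Longrightarrow> f \<xi> = h \<xi>" "\<eta> \<in> sector N"
  shows "(shift l ^^ n) f \<eta> = (shift l ^^ n) h \<eta>"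
  using assms(2)
proof (induction n arbitrary: \<eta>)
  case (Suc n)
  thus ?case using gen_cong[OF Suc.prems Suc.IH] by (simp add: shift_def)
qed (simp add: assms(1))

text \<open>Jumps stay in the sector, so values of \<open>f\<close> elsewhere are never seen. This
  allows passing to extensional restrictions and to cut-off functions.\<close>

lemma heat_cong:
  assumes "\<And>\<xi>. \<xi> \<in> sector N \<Longrightarrow> f \<xi> = h \<xi>" "\<eta> \<in> sector N"
  shows "heat l t f \<eta> = heat l t h \<eta>"
  using shift_pow_cong[OF assms] by (simp add: heat_def exp_shift_def)

lemma shift_pow_lin:
  assumes f: "sector_bounded f" and h: "sector_bounded h" and "\<eta> \<in> sector N"
  shows "(shift l ^^ n) (\<lambda>\<xi>. a * f \<xi> + b * h \<xi>) \<eta> = a * (shift l ^^ n) f \<eta> + b * (shift l ^^ n) h \<eta>"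
  using assms(3)
proof (induction n arbitrary: \<eta>)
  case (Suc n)
  have "gen ((shift l ^^ n) (\<lambda>\<xi>. a * f \<xi> + b * h \<xi>)) \<eta> =
      gen (\<lambda>\<xi>. a * (shift l ^^ n) f \<xi> + b * (shift l ^^ n) h \<xi>) \<eta>"
    by (rule gen_cong[OF Suc.prems Suc.IH])
  also have "\<dots> = a * gen ((shift l ^^ n) f) \<eta> + b * gen ((shift l ^^ n) h) \<eta>"
    by (intro gen_lin[OF _ _ Suc.prems] sector_bounded_shift_pow f h)
  finally show ?case
    unfolding shift_pow_Suc Suc.IH[OF Suc.prems] by (simp add: algebra_simps)
qed simp

lemma heat_lin:
  assumes f: "sector_bounded f" and h: "sector_bounded h" and \<eta>: "\<eta> \<in> sector N"
  shows "heat l t (\<lambda>\<xi>. a * f \<xi> + b * h \<xi>) \<eta> = a * heat l t f \<eta> + b * heat l t h \<eta>"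
proof -
  have "exp_shift l t (\<lambda>\<xi>. a * f \<xi> + b * h \<xi>) \<eta> =
      (\<Sum>n. a * ((shift l ^^ n) f \<eta> / fact n * t ^ n) + b * ((shift l ^^ n) h \<eta> / fact n * t ^ n))"
    unfolding exp_shift_def shift_pow_lin[OF f h \<eta>] by (simp add: add_divide_distrib algebra_simps)
  also have "\<dots> = a * exp_shift l t f \<eta> + b * exp_shift l t h \<eta>"
    unfolding exp_shift_def
    by (intro sums_unique[symmetric] sums_add sums_mult summable_sums
        summable_exp_shift[OF f \<eta>] summable_exp_shift[OF h \<eta>])
  finally show ?thesis by (simp add: heat_def algebra_simps)
qed

lemma heat_lipschitz_bound:
  assumes f: "lipschitz_bound p f c" and t: "0 \<le> t"
    and \<eta>: "\<eta> \<in> finite_configs" and \<zeta>: "\<zeta> \<in> finite_configs"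
  shows "\<bar>heat l t f \<eta> - heat l t f \<zeta>\<bar> \<le> c * exp (3 * a0 * t) * cdist p \<eta> \<zeta>"
proof (rule heat_lipschitz[OF lipschitz_sector_bounded[OF f] lipschitz_bound_nonneg[OF f] t _ \<eta> \<zeta>])
  fix \<xi> :: "'d config" and u assume "\<xi> \<in> finite_configs"
  hence "\<xi> \<in> Omega' p" using finite_configs_subset_Omega' by blast
  thus "\<bar>f (add_particle \<xi> u) - f \<xi>\<bar> \<le> c * beta p u"
    using lipschitz_boundD[OF f, of "add_particle \<xi> u" \<xi>]
    by (simp add: add_particle_Omega'_iff cdist_add_particle)
qed

text \<open>\<open>heat\<close> is controlled only on finite configurations; a fixed approximating
  sequence determines the extension. The parameter 0 is a mere representative in view of
  \<open>heat_indep\<close>, and the restriction produces an extensional function.\<close>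

definition semigroup :: "real \<Rightarrow> ('d config \<Rightarrow> real) \<Rightarrow> 'd config \<Rightarrow> real" where
  "semigroup t f = (\<lambda>\<eta>\<in>Omega' p. lim (\<lambda>n. heat 0 t f (truncate n \<eta>)))"

text \<open>The Lipschitz bound on finite configurations has a constant free of the particle number,
  so values along the truncations form a Cauchy sequence.\<close>

lemma semigroup_tendsto:
  assumes f: "lipschitz_bound p f c" and t: "0 \<le> t" and \<eta>: "\<eta> \<in> Omega' p"
  shows "(\<lambda>n. heat 0 t f (truncate n \<eta>)) \<longlonglongrightarrow> semigroup t f \<eta>"
proof -
  define C where "C = c * exp (3 * a0 * t)"
  have C: "0 \<le> C" using lipschitz_bound_nonneg[OF f] by (simp add: C_def)
  let ?d = "\<lambda>n. cdist p (truncate n \<eta>) \<eta>"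
  have lim: "(\<lambda>n. C * ?d n) \<longlonglongrightarrow> 0"
    using tendsto_mult_right_zero[OF cdist_truncate_tendsto[OF \<eta>]] .
  have "Cauchy (\<lambda>n. heat 0 t f (truncate n \<eta>))"
  proof (rule CauchyI)
    fix e :: real assume "0 < e"
    hence "eventually (\<lambda>n. C * ?d n < e / 2) sequentially"
      using order_tendstoD(2)[OF lim, of "e / 2"] by simp
    then obtain M where M: "\<And>n. M \<le> n \<Longrightarrow> C * ?d n < e / 2" by (auto simp: eventually_sequentially)
    have "norm (heat 0 t f (truncate m \<eta>) - heat 0 t f (truncate n \<eta>)) < e" if "M \<le> m" "M \<le> n" for m n
    proof -
      have "\<bar>heat 0 t f (truncate m \<eta>) - heat 0 t f (truncate n \<eta>)\<bar> \<le> C * cdist p (truncate m \<eta>) (truncate n \<eta>)"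
        unfolding C_def by (intro heat_lipschitz_bound[OF f t] truncate_finite_configs)
      also have "\<dots> \<le> C * (?d m + ?d n)"
        using cdist_triangle[OF truncate_Omega'[of m \<eta>] truncate_Omega'[of n \<eta>] \<eta>] C
        by (intro mult_left_mono) (simp_all add: cdist_commute[of p \<eta>])
      also have "\<dots> < e" using M[OF that(1)] M[OF that(2)] by (simp add: distrib_left)
      finally show ?thesis by simp
    qed
    thus "\<exists>M. \<forall>m\<ge>M. \<forall>n\<ge>M. norm (heat 0 t f (truncate m \<eta>) - heat 0 t f (truncate n \<eta>)) < e" by blast
  qed
  hence "convergent (\<lambda>n. heat 0 t f (truncate n \<eta>))" by (rule Cauchy_convergent)
  thus ?thesis using \<eta> by (simp add: semigroup_def convergent_LIMSEQ_iff)
qed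

lemma semigroup_finite:
  assumes "\<eta> \<in> finite_configs"
  shows "semigroup t f \<eta> = heat 0 t f \<eta>"
proof -
  have "(\<lambda>n. heat 0 t f (truncate n \<eta>)) \<longlonglongrightarrow> heat 0 t f \<eta>"
    using truncate_eventually_eq[OF assms] by (intro tendsto_eventually) (auto elim: eventually_mono)
  moreover have "\<eta> \<in> Omega' p" using assms finite_configs_subset_Omega' by blast
  ultimately show ?thesis by (simp add: semigroup_def limI)
qed

lemma semigroup_lipschitz:
  assumes f: "lipschitz_bound p f c" and t: "0 \<le> t"
  shows "lipschitz_bound p (semigroup t f) (c * exp (3 * a0 * t))"
  unfolding lipschitz_bound_def
proof (intro ballI)
  fix \<eta> \<zeta> :: "'d config" assume \<eta>: "\<eta> \<in> Omega' p" and \<zeta>: "\<zeta> \<in> Omega' p"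
  show "\<bar>semigroup t f \<eta> - semigroup t f \<zeta>\<bar> \<le> c * exp (3 * a0 * t) * cdist p \<eta> \<zeta>"
  proof (rule LIMSEQ_le_const2)
    show "(\<lambda>n. \<bar>heat 0 t f (truncate n \<eta>) - heat 0 t f (truncate n \<zeta>)\<bar>) \<longlonglongrightarrow> \<bar>semigroup t f \<eta> - semigroup t f \<zeta>\<bar>"
      by (intro tendsto_intros semigroup_tendsto[OF f t] \<eta> \<zeta>)
    have "\<bar>heat 0 t f (truncate n \<eta>) - heat 0 t f (truncate n \<zeta>)\<bar> \<le> c * exp (3 * a0 * t) * cdist p \<eta> \<zeta>" for n
    proof -
      have "\<bar>heat 0 t f (truncate n \<eta>) - heat 0 t f (truncate n \<zeta>)\<bar> \<le> c * exp (3 * a0 * t) * cdist p (truncate n \<eta>) (truncate n \<zeta>)"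
        by (intro heat_lipschitz_bound[OF f t] truncate_finite_configs)
      also have "\<dots> \<le> c * exp (3 * a0 * t) * cdist p \<eta> \<zeta>"
        using lipschitz_bound_nonneg[OF f] by (intro mult_left_mono cdist_truncate_le \<eta> \<zeta>) auto
      finally show ?thesis .
    qed
    thus "\<exists>N. \<forall>n\<ge>N. \<bar>heat 0 t f (truncate n \<eta>) - heat 0 t f (truncate n \<zeta>)\<bar> \<le> c * exp (3 * a0 * t) * cdist p \<eta> \<zeta>"
      by blast
  qed
qed

lemma semigroup_Lip: "f \<in> Lip p \<Longrightarrow> 0 \<le> t \<Longrightarrow> semigroup t f \<in> Lip p"
  using semigroup_lipschitz by (auto simp: Lip_def semigroup_def)

text \<open>The semigroup identities are checked along truncations, where they hold for
  \<open>heat\<close>, and transferred by uniqueness of limits.\<close>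

lemma Lip_eqI:
  assumes "f \<in> extensional (Omega' p)" "h \<in> extensional (Omega' p)"
    and "\<And>\<eta>. \<eta> \<in> Omega' p \<Longrightarrow> (\<lambda>n. u n \<eta>) \<longlonglongrightarrow> f \<eta>" "\<And>\<eta>. \<eta> \<in> Omega' p \<Longrightarrow> (\<lambda>n. u n \<eta>) \<longlonglongrightarrow> h \<eta>"
  shows "f = (h :: 'd config \<Rightarrow> real)"
  using assms by (intro extensionalityI[of f "Omega' p" h]) (auto intro: LIMSEQ_unique)

lemma semigroup_lin:
  assumes f: "f \<in> Lip p" and h: "h \<in> Lip p" and t: "0 \<le> t"
  shows "semigroup t (\<lambda>\<eta>\<in>Omega' p. a * f \<eta> + b * h \<eta>) =
    (\<lambda>\<eta>\<in>Omega' p. a * semigroup t f \<eta> + b * semigroup t h \<eta>)"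
proof -
  let ?k = "\<lambda>\<eta>\<in>Omega' p. a * f \<eta> + b * h \<eta>"
  obtain c where c: "lipschitz_bound p f c" using f by (auto simp: Lip_def)
  obtain d where d: "lipschitz_bound p h d" using h by (auto simp: Lip_def)
  have k: "lipschitz_bound p ?k (\<bar>a\<bar> * c + \<bar>b\<bar> * d)"
    unfolding lipschitz_bound_def
  proof (intro ballI)
    fix \<eta> \<zeta> :: "'d config" assume \<eta>: "\<eta> \<in> Omega' p" and \<zeta>: "\<zeta> \<in> Omega' p"
    have "\<bar>?k \<eta> - ?k \<zeta>\<bar> = \<bar>a * (f \<eta> - f \<zeta>) + b * (h \<eta> - h \<zeta>)\<bar>"
      using \<eta> \<zeta> by (simp add: algebra_simps)
    also have "\<dots> \<le> \<bar>a\<bar> * \<bar>f \<eta> - f \<zeta>\<bar> + \<bar>b\<bar> * \<bar>h \<eta> - h \<zeta>\<bar>"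
      by (simp only: abs_triangle_ineq flip: abs_mult)
    also have "\<dots> \<le> \<bar>a\<bar> * (c * cdist p \<eta> \<zeta>) + \<bar>b\<bar> * (d * cdist p \<eta> \<zeta>)"
      by (intro add_mono mult_left_mono lipschitz_boundD[OF c \<eta> \<zeta>] lipschitz_boundD[OF d \<eta> \<zeta>]) auto
    finally show "\<bar>?k \<eta> - ?k \<zeta>\<bar> \<le> (\<bar>a\<bar> * c + \<bar>b\<bar> * d) * cdist p \<eta> \<zeta>" by (simp add: algebra_simps)
  qed
  have eq: "heat 0 t ?k (truncate n \<eta>) = a * heat 0 t f (truncate n \<eta>) + b * heat 0 t h (truncate n \<eta>)" for n \<eta>
  proof -
    obtain N where N: "truncate n \<eta> \<in> sector N"
      using truncate_finite_configs[of n \<eta>] by (auto simp: finite_configs_eq_sector)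
    \<comment> \<open>The restricted combination \<open>?k\<close> differs from the plain one only
      off \<open>\<Omega>'\<close>, hence on no sector.\<close>
    have "heat 0 t ?k (truncate n \<eta>) = heat 0 t (\<lambda>\<xi>. a * f \<xi> + b * h \<xi>) (truncate n \<eta>)"
      using finite_configs_subset_Omega'[of p] sector_finite_configs
      by (intro heat_cong[OF _ N]) (auto simp: subset_iff)
    thus ?thesis using heat_lin[OF Lip_sector_bounded[OF f] Lip_sector_bounded[OF h] N] by simp
  qed
  show ?thesis
  proof (rule Lip_eqI)
    fix \<eta> :: "'d config" assume \<eta>: "\<eta> \<in> Omega' p"
    show "(\<lambda>n. heat 0 t ?k (truncate n \<eta>)) \<longlonglongrightarrow> semigroup t ?k \<eta>"
      by (rule semigroup_tendsto[OF k t \<eta>])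
    have "(\<lambda>n. heat 0 t ?k (truncate n \<eta>)) \<longlonglongrightarrow> a * semigroup t f \<eta> + b * semigroup t h \<eta>"
      unfolding eq by (intro tendsto_intros semigroup_tendsto[OF c t \<eta>] semigroup_tendsto[OF d t \<eta>])
    thus "(\<lambda>n. heat 0 t ?k (truncate n \<eta>)) \<longlonglongrightarrow> (\<lambda>\<eta>\<in>Omega' p. a * semigroup t f \<eta> + b * semigroup t h \<eta>) \<eta>"
      using \<eta> by simp
  qed (simp_all add: semigroup_def)
qed

lemma semigroup_0:
  assumes f: "f \<in> Lip p"
  shows "semigroup 0 f = f"
proof -
  obtain c where c: "lipschitz_bound p f c" using f by (auto simp: Lip_def)
  show ?thesis
  proof (rule Lip_eqI)
    fix \<eta> :: "'d config" assume \<eta>: "\<eta> \<in> Omega' p"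
    show "(\<lambda>n. heat 0 0 f (truncate n \<eta>)) \<longlonglongrightarrow> semigroup 0 f \<eta>"
      by (rule semigroup_tendsto[OF c order_refl \<eta>])
    have "(\<lambda>n. f (truncate n \<eta>) - f \<eta>) \<longlonglongrightarrow> 0"
    proof (rule Lim_null_comparison)
      show "(\<lambda>n. c * cdist p (truncate n \<eta>) \<eta>) \<longlonglongrightarrow> 0"
        using tendsto_mult_right_zero[OF cdist_truncate_tendsto[OF \<eta>]] .
      show "eventually (\<lambda>n. norm (f (truncate n \<eta>) - f \<eta>) \<le> c * cdist p (truncate n \<eta>) \<eta>) sequentially"
        using lipschitz_boundD[OF c truncate_Omega' \<eta>] by (intro always_eventually) simp
    qed
    thus "(\<lambda>n. heat 0 0 f (truncate n \<eta>)) \<longlonglongrightarrow> f \<eta>" by (simp add: heat_0 LIM_zero_iff)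
  qed (use f in \<open>simp_all add: semigroup_def Lip_def\<close>)
qed

lemma semigroup_add:
  assumes f: "f \<in> Lip p" and s: "0 \<le> s" and t: "0 \<le> t"
  shows "semigroup (t + s) f = semigroup t (semigroup s f)"
proof -
  obtain c where c: "lipschitz_bound p f c" using f by (auto simp: Lip_def)
  show ?thesis
  proof (rule Lip_eqI)
    fix \<eta> :: "'d config" assume \<eta>: "\<eta> \<in> Omega' p"
    show "(\<lambda>n. heat 0 (t + s) f (truncate n \<eta>)) \<longlonglongrightarrow> semigroup (t + s) f \<eta>"
      using s t by (intro semigroup_tendsto[OF c _ \<eta>]) simp
    have "heat 0 (t + s) f (truncate n \<eta>) = heat 0 t (semigroup s f) (truncate n \<eta>)" for n
    proof -
      obtain N where N: "truncate n \<eta> \<in> sector N"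
        using truncate_finite_configs[of n \<eta>] by (auto simp: finite_configs_eq_sector)
      have "heat 0 (t + s) f (truncate n \<eta>) = heat 0 t (heat 0 s f) (truncate n \<eta>)"
        by (rule heat_semigroup_shift[OF Lip_sector_bounded[OF f] N t s])
      also have "\<dots> = heat 0 t (semigroup s f) (truncate n \<eta>)"
        by (intro heat_cong[OF _ N]) (simp add: semigroup_finite sector_finite_configs)
      finally show ?thesis .
    qed
    thus "(\<lambda>n. heat 0 (t + s) f (truncate n \<eta>)) \<longlonglongrightarrow> semigroup t (semigroup s f) \<eta>"
      using semigroup_tendsto[OF semigroup_lipschitz[OF c s] t \<eta>] by simp
  qed (simp_all add: semigroup_def)
qed

section \<open>The integral equation\<close>

lemma zr_gen_semigroup_finite:
  assumes f: "f \<in> Lip p" and s: "0 \<le> s" and \<eta>: "\<eta> \<in> sector N"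
  shows "zr_gen p g (semigroup s f) \<eta> = gen (heat 0 s f) \<eta>"
proof -
  have "zr_gen p g (semigroup s f) \<eta> = gen (semigroup s f) \<eta>"
    by (intro zr_gen_finite[OF _ \<eta>] Lip_sector_bounded[where p = p] semigroup_Lip f s)
  also have "\<dots> = gen (heat 0 s f) \<eta>"
    by (intro gen_cong[OF \<eta>] semigroup_finite sector_finite_configs)
  finally show ?thesis .
qed

lemma semigroup_integral_finite:
  assumes f: "f \<in> Lip p" and t: "0 \<le> t" and \<eta>: "\<eta> \<in> sector N"
  shows "set_integrable lborel {0..t} (\<lambda>s. zr_gen p g (semigroup s f) \<eta>)"
    and "(LINT s:{0..t}|lborel. zr_gen p g (semigroup s f) \<eta>) = heat 0 t f \<eta> - f \<eta>"
proof -
  note sb = Lip_sector_bounded[OF f]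
  let ?G = "\<lambda>s. gen (heat 0 s f) \<eta>"
  have cont: "continuous_on {0..t} ?G"
    using continuous_on_gen_heat[OF sb \<eta>] by (rule continuous_on_subset) auto
  have "set_integrable lborel {0..t} ?G \<longleftrightarrow> set_integrable lborel {0..t} (\<lambda>s. zr_gen p g (semigroup s f) \<eta>)"
    by (intro set_integrable_cong refl) (simp add: zr_gen_semigroup_finite[OF f _ \<eta>])
  thus "set_integrable lborel {0..t} (\<lambda>s. zr_gen p g (semigroup s f) \<eta>)"
    using borel_integrable_atLeastAtMost'[OF cont] by simp
  have "(LINT s:{0..t}|lborel. zr_gen p g (semigroup s f) \<eta>) = (LINT s:{0..t}|lborel. ?G s)"
    by (intro set_lebesgue_integral_cong) (simp_all add: zr_gen_semigroup_finite[OF f _ \<eta>])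
  also have "\<dots> = heat 0 t f \<eta> - heat 0 0 f \<eta>"
    unfolding set_lebesgue_integral_def
    by (rule integral_FTC_atLeastAtMost[OF t _ cont])
      (use heat_deriv[OF sb \<eta>] in \<open>simp add: has_real_derivative_iff_has_vector_derivative has_vector_derivative_at_within\<close>)
  finally show "(LINT s:{0..t}|lborel. zr_gen p g (semigroup s f) \<eta>) = heat 0 t f \<eta> - f \<eta>"
    by (simp add: heat_0)
qed

text \<open>The identity for finite configurations is passed to the limit along truncations;
  \<open>zr_gen_bound\<close>, with the Lipschitz constant taken at the final time, dominates the
  integrands uniformly.\<close>

lemma semigroup_integral:
  assumes f: "f \<in> Lip p" and t: "0 \<le> t" and \<eta>: "\<eta> \<in> Omega' p"
  shows "set_integrable lborel {0..t} (\<lambda>s. zr_gen p g (semigroup s f) \<eta>)"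
    and "semigroup t f \<eta> = f \<eta> + (LINT s:{0..t}|lborel. zr_gen p g (semigroup s f) \<eta>)"
proof -
  obtain c where c: "lipschitz_bound p f c" using f by (auto simp: Lip_def)
  note c0 = lipschitz_bound_nonneg[OF c]
  let ?F = "\<lambda>n s. indicator {0..t} s *\<^sub>R zr_gen p g (semigroup s f) (truncate n \<eta>)"
  let ?F' = "\<lambda>s. indicator {0..t} s *\<^sub>R zr_gen p g (semigroup s f) \<eta>"
  let ?C = "3 * a0 * (c * exp (3 * a0 * t)) * (\<Sum>\<^sub>\<infinity>x. real (\<eta> x) * beta p x)"
  let ?w = "\<lambda>s. indicator {0..t} s *\<^sub>R ?C"
  have fin: "set_integrable lborel {0..t} (\<lambda>s. zr_gen p g (semigroup s f) (truncate n \<eta>))"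
    "(LINT s:{0..t}|lborel. zr_gen p g (semigroup s f) (truncate n \<eta>)) = heat 0 t f (truncate n \<eta>) - f (truncate n \<eta>)" for n
    using truncate_finite_configs[of n \<eta>] semigroup_integral_finite[OF f t]
    by (auto simp: finite_configs_eq_sector)
  have lim: "(\<lambda>n. ?F n s) \<longlonglongrightarrow> ?F' s" for s
    using zr_gen_truncate_tendsto[OF semigroup_lipschitz[OF c] \<eta>]
    by (cases "s \<in> {0..t}") simp_all
  have meas: "?F n \<in> borel_measurable lborel" for n
    using fin(1)[of n] by (auto simp: set_integrable_def)
  \<comment> \<open>Measurability in time on infinite configurations is inherited as a pointwise
    limit from the finite case, where the integrand is integrable.\<close>
  have meas': "?F' \<in> borel_measurable lborel"
    by (rule borel_measurable_LIMSEQ_real[OF lim meas])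
  have w: "integrable lborel ?w"
    unfolding set_integrable_def[symmetric] by (rule borel_integrable_atLeastAtMost') simp
  have bnd: "norm (?F n s) \<le> ?w s" for n s
  proof (cases "s \<in> {0..t}")
    case True
    hence s: "0 \<le> s" "s \<le> t" by auto
    have "\<bar>zr_gen p g (semigroup s f) (truncate n \<eta>)\<bar> \<le>
        3 * a0 * (c * exp (3 * a0 * s)) * (\<Sum>\<^sub>\<infinity>x. real (truncate n \<eta> x) * beta p x)"
      by (intro zr_gen_bound[OF semigroup_lipschitz[OF c s(1)]] truncate_Omega')
    also have "\<dots> \<le> ?C"
    proof (intro mult_mono)
      show "exp (3 * a0 * s) \<le> exp (3 * a0 * t)" using s a0_nonneg by (simp add: mult_left_mono)
      show "(\<Sum>\<^sub>\<infinity>x. real (truncate n \<eta> x) * beta p x) \<le> (\<Sum>\<^sub>\<infinity>x. real (\<eta> x) * beta p x)"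
        using truncate_Omega'[of n \<eta> p] \<eta> unfolding Omega'_iff
        by (intro infsum_mono) (auto simp: truncate_def beta_nonneg)
    qed (auto intro!: infsum_nonneg mult_nonneg_nonneg a0_nonneg c0 beta_nonneg)
    finally show ?thesis using True by simp
  qed simp
  have AE: "AE s in lborel. (\<lambda>n. ?F n s) \<longlonglongrightarrow> ?F' s" "AE s in lborel. norm (?F n s) \<le> ?w s" for n
    using lim bnd by simp_all
  show "set_integrable lborel {0..t} (\<lambda>s. zr_gen p g (semigroup s f) \<eta>)"
    unfolding set_integrable_def by (rule integrable_dominated_convergence[OF meas' meas w AE])
  have "(\<lambda>n. integral\<^sup>L lborel (?F n)) \<longlonglongrightarrow> integral\<^sup>L lborel ?F'"
    by (rule integral_dominated_convergence[OF meas' meas w AE])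
  \<comment> \<open>The initial value is written as \<open>heat 0 0 f\<close> so that its limit is
    another instance of \<open>semigroup_tendsto\<close>.\<close>
  moreover have "integral\<^sup>L lborel (?F n) = heat 0 t f (truncate n \<eta>) - heat 0 0 f (truncate n \<eta>)" for n
    using fin(2)[of n] by (simp add: set_lebesgue_integral_def heat_0)
  moreover have "(\<lambda>n. heat 0 t f (truncate n \<eta>) - heat 0 0 f (truncate n \<eta>)) \<longlonglongrightarrow> semigroup t f \<eta> - semigroup 0 f \<eta>"
    by (intro tendsto_diff semigroup_tendsto[OF c _ \<eta>] t order_refl)
  ultimately have "integral\<^sup>L lborel ?F' = semigroup t f \<eta> - semigroup 0 f \<eta>"
    by (auto intro: LIMSEQ_unique)
  thus "semigroup t f \<eta> = f \<eta> + (LINT s:{0..t}|lborel. zr_gen p g (semigroup s f) \<eta>)"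
    by (simp add: set_lebesgue_integral_def semigroup_0[OF f])
qed

end

section \<open>Transition functions with the given generator\<close>

lemma expectation_bind_pmf:
  fixes f :: "'b \<Rightarrow> real"
  assumes "\<And>y. y \<in> (\<Union>x\<in>set_pmf M. set_pmf (N x)) \<Longrightarrow> \<bar>f y\<bar> \<le> B"
  shows "measure_pmf.expectation (bind_pmf M N) f = measure_pmf.expectation M (\<lambda>x. measure_pmf.expectation (N x) f)"
proof -
  let ?S = "\<Union>x\<in>set_pmf M. set_pmf (N x)"
  \<comment> \<open>The bound holds only on the support, so \<open>f\<close> is replaced by a
    globally bounded function equal to it almost surely.\<close>
  define h where "h y = (if y \<in> ?S then f y else 0)" for y
  obtain x y where "x \<in> set_pmf M" "y \<in> set_pmf (N x)" by (meson set_pmf_not_empty ex_in_conv)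
  hence B: "0 \<le> B" using assms[of y] by force
  have "measure_pmf.expectation (bind_pmf M N) f = measure_pmf.expectation (bind_pmf M N) h"
    by (intro integral_cong_AE) (auto simp: AE_measure_pmf_iff h_def)
  also have "\<dots> = measure_pmf.expectation M (\<lambda>x. measure_pmf.expectation (N x) h)"
    unfolding measure_pmf_bind
    by (rule integral_bind[where K = "count_space UNIV" and B = B and B' = 1])
      (use assms B measurable_measure_pmf[of N] in
        \<open>auto simp: h_def measure_pmf.emeasure_space_1 measure_pmf.finite_measure_axioms\<close>)
  also have "\<dots> = measure_pmf.expectation M (\<lambda>x. measure_pmf.expectation (N x) f)"
    by (intro integral_cong_AE AE_pmfI) (auto simp: AE_measure_pmf_iff h_def intro!: integral_cong_AE)
  finally show ?thesis .
qed

text \<open>A probability measure carried by a countable set is concentrated on its atoms, which is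
  what makes it a pmf.\<close>

lemma distr_pmf:
  assumes "prob_space M" and Y: "Y \<in> measurable M (count_space S)" and S: "countable S"
  obtains K where "measure_pmf K = distr M (count_space UNIV) Y" "set_pmf K \<subseteq> S"
proof -
  interpret prob_space M by fact
  have Y': "Y \<in> measurable M (count_space UNIV)"
    using measurable_compose[OF Y, of "\<lambda>x. x" "count_space UNIV"] by simp
  let ?D = "distr M (count_space UNIV) Y"
  interpret D: prob_space ?D by (rule prob_space_distr[OF Y'])
  have "AE x in ?D. x \<in> S"
    using measurable_space[OF Y] by (subst AE_distr_iff[OF Y']) auto
  moreover from this have "AE x in ?D. measure ?D {x} \<noteq> 0"
    using S by (subst D.AE_support_countable) auto
  ultimately have K: "measure_pmf (Abs_pmf ?D) = ?D" and "AE x in ?D. x \<in> S"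
    using D.prob_space_axioms by (simp_all add: Abs_pmf_inverse)
  hence "AE x in measure_pmf (Abs_pmf ?D). x \<in> S" by (simp only: K)
  hence "set_pmf (Abs_pmf ?D) \<subseteq> S" unfolding AE_measure_pmf_iff by blast
  thus thesis by (rule that[OF K])
qed

lemma expectation_sum_indicator:
  fixes v :: "'a \<Rightarrow> real"
  assumes "finite Y" "\<And>y. y \<in> set_pmf M \<Longrightarrow> \<bar>v y\<bar> \<le> B"
  shows "measure_pmf.expectation M v =
    (\<Sum>y\<in>Y. v y * pmf M y) + measure_pmf.expectation M (\<lambda>y. v y * indicator (- Y) y)"
proof -
  have "measure_pmf.expectation M v =
      measure_pmf.expectation M (\<lambda>y. v y * indicator Y y + v y * indicator (- Y) y)"
    by (intro Bochner_Integration.integral_cong) (auto simp: indicator_def)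
  also have "\<dots> = measure_pmf.expectation M (\<lambda>y. v y * indicator Y y) +
      measure_pmf.expectation M (\<lambda>y. v y * indicator (- Y) y)"
    using assms(2)
    by (intro Bochner_Integration.integral_add integrable_pmf_bounded[where B = B])
      (force simp: indicator_def)+
  also have "measure_pmf.expectation M (\<lambda>y. v y * indicator Y y) = (\<Sum>y\<in>Y. v y * pmf M y)"
    by (subst integral_measure_pmf[OF assms(1)]) (auto simp: indicator_def split: if_splits intro!: sum.cong)
  finally show ?thesis .
qed

text \<open>What the identification takes from a chain: its transition laws, Chapman-Kolmogorov, and
  entrywise right derivatives at time 0. Conservation of the particle number is not put in; it comes
  out as \<open>K_sector\<close>.\<close>

locale generated_semigroup = zero_range p g a0
  for p :: "'d::finite site \<Rightarrow> 'd site pmf" and g a0 +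
  fixes K :: "real \<Rightarrow> 'd config \<Rightarrow> 'd config pmf"
  assumes countable_configs: "countable (finite_configs :: 'd config set)"
    and K_0: "x \<in> finite_configs \<Longrightarrow> K 0 x = return_pmf x"
    and K_set: "x \<in> finite_configs \<Longrightarrow> 0 \<le> t \<Longrightarrow> set_pmf (K t x) \<subseteq> finite_configs"
    and K_add: "x \<in> finite_configs \<Longrightarrow> 0 \<le> s \<Longrightarrow> 0 \<le> t \<Longrightarrow> K (s + t) x = bind_pmf (K s x) (K t)"
    and K_deriv: "x \<in> finite_configs \<Longrightarrow> y \<in> finite_configs \<Longrightarrow>
      ((\<lambda>t. pmf (K t x) y) has_real_derivative gen (indicator {y}) x) (at 0 within {0..})"
begin

lemma sector_bounded_bounded: "(\<And>y. y \<in> finite_configs \<Longrightarrow> \<bar>v y\<bar> \<le> B) \<Longrightarrow> sector_bounded v"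
  by (rule sector_boundedI[where B = "\<lambda>_. B"]) (simp add: sector_finite_configs)

lemma gen_sum_indicator:
  fixes v :: "'d config \<Rightarrow> real"
  assumes "finite Y" and v: "sector_bounded v" and x: "x \<in> sector N"
  shows "gen v x = (\<Sum>y\<in>Y. v y * gen (indicator {y}) x) + gen (\<lambda>y. v y * indicator (- Y) y) x"
  using assms(1)
proof (induction Y rule: finite_induct)
  case empty
  show ?case by simp
next
  case (insert z Y)
  have bnd: "sector_bounded (\<lambda>y. v y * indicator A y)" for A
  proof (rule sector_boundedI)
    fix M and \<xi> :: "'d config" assume "\<xi> \<in> sector M"
    thus "\<bar>v \<xi> * indicator A \<xi>\<bar> \<le> (SOME B. \<forall>\<xi>\<in>sector M. \<bar>v \<xi>\<bar> \<le> B)"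
      using someI_ex[of "\<lambda>B. \<forall>\<xi>\<in>sector M. \<bar>v \<xi>\<bar> \<le> B"] v
      unfolding sector_bounded_def indicator_def by force
  qed
  have ind: "sector_bounded (indicator {z})"
    by (rule sector_bounded_bounded[where B = 1]) (simp add: indicator_def)
  have "(\<lambda>y. v y * indicator (- Y) y) =
      (\<lambda>y. v z * indicator {z} y + 1 * (v y * indicator (- insert z Y) y))"
  proof
    fix y
    show "v y * indicator (- Y) y = v z * indicator {z} y + 1 * (v y * indicator (- insert z Y) y)"
      using insert.hyps by (cases "y = z") (simp_all add: indicator_def)
  qed
  hence "gen (\<lambda>y. v y * indicator (- Y) y) x =
      v z * gen (indicator {z}) x + 1 * gen (\<lambda>y. v y * indicator (- insert z Y) y) x"
    using gen_lin[OF ind bnd[of "- insert z Y"] x, where a = "v z" and b = 1] by simp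
  thus ?case using insert by simp
qed

text \<open>Outside a large finite set \<open>Y\<close> the generator has little mass at \<open>x\<close>. As the masses of
  \<open>K h x\<close> on \<open>Y\<close> are controlled by the derivatives at \<open>0\<close> and the total mass is \<open>1\<close>, so has
  \<open>K h x / h\<close>; this makes the derivative of \<open>K\<close> at \<open>0\<close> uniform over bounded functions.\<close>

lemma K_deriv_uniform:
  assumes x: "x \<in> finite_configs" and B: "0 \<le> B" and e: "0 < e"
  shows "\<exists>\<delta>>0. \<forall>h v. 0 < h \<longrightarrow> h < \<delta> \<longrightarrow> (\<forall>y\<in>finite_configs. \<bar>v y\<bar> \<le> B) \<longrightarrow>
    \<bar>measure_pmf.expectation (K h x) v - v x - h * gen v x\<bar> \<le> e * h"
proof -
  obtain N where N: "x \<in> sector N" using x by (auto simp: finite_configs_eq_sector)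
  \<comment> \<open>The error will consist of four multiples of \<open>B * e' * h\<close>: one from
    \<open>Y\<close>, two from the mass of \<open>K h x\<close> off \<open>Y\<close>, one from the
    generator off \<open>Y\<close>. The \<open>+ 1\<close> covers \<open>B = 0\<close>.\<close>
  define e' where "e' = e / (4 * B + 1)"
  have e': "0 < e'" "4 * B * e' \<le> e" using e B by (auto simp: e'_def field_simps)
  \<comment> \<open>Finite sets exhausting the countable state space; \<open>x\<close> is included
    so that functions supported off \<open>E n\<close> vanish at \<open>x\<close>.\<close>
  define E where "E n = insert x (from_nat_into finite_configs ` {..<n})" for n :: nat
  have "(\<lambda>n. gen (indicator (- E n)) x) \<longlonglongrightarrow> gen (\<lambda>_. 0) x"
  proof (rule gen_tendsto[OF N])
    fix \<xi> :: "'d config" assume "\<xi> \<in> sector N"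
    hence "\<xi> \<in> finite_configs" by (rule sector_finite_configs)
    then obtain k where "\<xi> = from_nat_into finite_configs k"
      using countable_configs by (metis from_nat_into_to_nat_on)
    have "eventually (\<lambda>n. indicator (- E n) \<xi> = (0::real)) sequentially"
      using eventually_gt_at_top[of k] by eventually_elim (auto simp: E_def \<open>\<xi> = _\<close>)
    thus "(\<lambda>n. indicator (- E n) \<xi>) \<longlonglongrightarrow> (0::real)" by (rule tendsto_eventually)
    show "\<bar>indicator (- E n) \<xi>\<bar> \<le> (1::real)" for n by (simp add: indicator_def)
  qed
  hence "eventually (\<lambda>n. gen (indicator (- E n)) x < e') sequentially"
    using e' by (intro order_tendstoD(2)) (simp_all add: gen_def)
  then obtain n where n: "gen (indicator (- E n)) x < e'" by (auto simp: eventually_sequentially)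
  define Y where "Y = E n"
  have Y: "finite Y" "x \<in> Y" "Y \<subseteq> finite_configs"
    using x by (auto simp: Y_def E_def intro: from_nat_into)
  have r: "gen (indicator (- Y)) x < e'" using n by (simp add: Y_def)
  define D where "D h y = (pmf (K h x) y - indicator {y} x) / h - gen (indicator {y}) x" for h y
  have "((\<lambda>h. \<Sum>y\<in>Y. \<bar>D h y\<bar>) \<longlongrightarrow> (\<Sum>y\<in>Y. \<bar>gen (indicator {y}) x - gen (indicator {y}) x\<bar>)) (at 0 within {0..})"
    unfolding D_def
  proof (intro tendsto_sum tendsto_rabs tendsto_diff tendsto_const)
    fix y assume "y \<in> Y"
    thus "((\<lambda>h. (pmf (K h x) y - indicator {y} x) / h) \<longlongrightarrow> gen (indicator {y}) x) (at 0 within {0..})"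
      using K_deriv[OF x, of y] Y by (auto simp: has_field_derivative_iff K_0[OF x])
  qed
  hence "eventually (\<lambda>h. (\<Sum>y\<in>Y. \<bar>D h y\<bar>) < e') (at 0 within {0..})"
    using e' by (intro order_tendstoD(2)) simp_all
  then obtain \<delta> where \<delta>: "0 < \<delta>" "\<And>h. 0 < h \<Longrightarrow> h < \<delta> \<Longrightarrow> (\<Sum>y\<in>Y. \<bar>D h y\<bar>) < e'"
    unfolding eventually_at by (force simp: dist_real_def)
  have "\<bar>measure_pmf.expectation (K h x) v - v x - h * gen v x\<bar> \<le> e * h"
    if h: "0 < h" "h < \<delta>" and v: "\<And>y. y \<in> finite_configs \<Longrightarrow> \<bar>v y\<bar> \<le> B" for h v
  proof -
    let ?E = "measure_pmf.expectation (K h x)"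
    have Kset: "set_pmf (K h x) \<subseteq> finite_configs" using h x by (intro K_set) auto
    \<comment> \<open>An exact identity, stated for general \<open>w\<close> because it is applied
      both to the constant 1 and to \<open>v\<close>.\<close>
    have decomp: "?E w - w x - h * gen w x = h * (\<Sum>y\<in>Y. w y * D h y) +
        ?E (\<lambda>y. w y * indicator (- Y) y) - h * gen (\<lambda>y. w y * indicator (- Y) y) x"
      if w: "\<And>y. y \<in> finite_configs \<Longrightarrow> \<bar>w y\<bar> \<le> C" for w C
    proof -
      have "h * (\<Sum>y\<in>Y. w y * D h y) =
          (\<Sum>y\<in>Y. w y * pmf (K h x) y - w y * indicator {y} x - h * (w y * gen (indicator {y}) x))"
        unfolding sum_distrib_left D_def using h by (intro sum.cong) (simp_all add: field_simps)
      also have "\<dots> = (\<Sum>y\<in>Y. w y * pmf (K h x) y) - w x - h * (\<Sum>y\<in>Y. w y * gen (indicator {y}) x)"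
        using Y by (simp add: sum_subtractf sum_distrib_left indicator_def if_distrib cong: if_cong)
      finally have "h * (\<Sum>y\<in>Y. w y * D h y) = \<dots>" .
      moreover have "?E w = (\<Sum>y\<in>Y. w y * pmf (K h x) y) + ?E (\<lambda>y. w y * indicator (- Y) y)"
        by (rule expectation_sum_indicator[OF Y(1)]) (use w Kset in blast)
      moreover have "gen w x = (\<Sum>y\<in>Y. w y * gen (indicator {y}) x) + gen (\<lambda>y. w y * indicator (- Y) y) x"
        by (rule gen_sum_indicator[OF Y(1) sector_bounded_bounded N]) (rule w)
      ultimately show ?thesis by (simp add: algebra_simps)
    qed
    have sumD: "\<bar>\<Sum>y\<in>Y. w y * D h y\<bar> \<le> C * e'" if w: "\<And>y. y \<in> finite_configs \<Longrightarrow> \<bar>w y\<bar> \<le> C" for w C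
    proof -
      have C: "0 \<le> C" using w[OF x] by linarith
      have "\<bar>\<Sum>y\<in>Y. w y * D h y\<bar> \<le> (\<Sum>y\<in>Y. \<bar>w y * D h y\<bar>)" by (rule sum_abs)
      also have "\<dots> \<le> (\<Sum>y\<in>Y. C * \<bar>D h y\<bar>)"
        unfolding abs_mult using w Y by (intro sum_mono mult_right_mono) auto
      also have "\<dots> \<le> C * e'"
        unfolding sum_distrib_left[symmetric] using \<delta>(2)[OF h] C by (intro mult_left_mono) auto
      finally show ?thesis .
    qed
    \<comment> \<open>For the constant 1 the left side of \<open>decomp\<close> is 0, which
      expresses the escaping mass through \<open>D\<close> and the generator off
      \<open>Y\<close>.\<close>
    have tail: "?E (indicator (- Y)) \<le> 2 * h * e'"
    proof -
      have "gen (\<lambda>_. 1) x = 0" by (simp add: gen_def)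
      hence "?E (indicator (- Y)) = h * (gen (indicator (- Y)) x - (\<Sum>y\<in>Y. D h y))"
        using decomp[of "\<lambda>_. 1" 1] by (simp add: algebra_simps)
      also have "\<dots> \<le> h * (e' + e')"
        using sumD[of "\<lambda>_. 1" 1] r h by (intro mult_left_mono) auto
      finally show ?thesis by simp
    qed
    have bv: "\<bar>v y * indicator (- Y) y\<bar> \<le> B * indicator (- Y) y" if "y \<in> finite_configs" for y
      using v[OF that] B by (simp add: indicator_def)
    have "\<bar>?E (\<lambda>y. v y * indicator (- Y) y)\<bar> \<le> ?E (\<lambda>y. \<bar>v y * indicator (- Y) y\<bar>)"
      by (rule integral_abs_bound)
    also have "\<dots> \<le> ?E (\<lambda>y. B * indicator (- Y) y)"
    proof (intro integral_mono_AE AE_pmfI integrable_pmf_bounded)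
      fix y assume "y \<in> set_pmf (K h x)"
      hence y: "y \<in> finite_configs" using Kset by blast
      show "\<bar>v y * indicator (- Y) y\<bar> \<le> B * indicator (- Y) y" by (rule bv[OF y])
      show "\<bar>\<bar>v y * indicator (- Y) y\<bar>\<bar> \<le> B" using v[OF y] B by (simp add: indicator_def)
      show "\<bar>B * indicator (- Y) y\<bar> \<le> B" using B by (simp add: indicator_def)
    qed
    also have "\<dots> \<le> B * (2 * h * e')" using tail B by (simp add: mult_left_mono)
    finally have t1: "\<bar>?E (\<lambda>y. v y * indicator (- Y) y)\<bar> \<le> B * (2 * h * e')" .
    \<comment> \<open>As \<open>x \<in> Y\<close>, the cut-off functions vanish at \<open>x\<close>;
      the diagonal term disappears and \<open>gen\<close> becomes a sum with nonnegative weights,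
      hence monotone.\<close>
    have "\<bar>gen (\<lambda>y. v y * indicator (- Y) y) x\<bar> \<le> B * gen (indicator (- Y)) x"
    proof -
      let ?u = "\<lambda>y. v y * indicator (- Y) y"
      have "gen w x = (\<Sum>z\<in>support x. g (x z) * measure_pmf.expectation (p z) (\<lambda>y. w (move x z y)))"
        if "w x = 0" for w
        unfolding gen_def that by simp
      note g0 = this
      have "\<bar>gen ?u x\<bar> \<le> (\<Sum>z\<in>support x. \<bar>g (x z) * measure_pmf.expectation (p z) (\<lambda>y. ?u (move x z y))\<bar>)"
        using Y by (subst g0) auto
      also have "\<dots> \<le> (\<Sum>z\<in>support x. g (x z) * (B * measure_pmf.expectation (p z) (\<lambda>y. indicator (- Y) (move x z y))))"
      proof (rule sum_mono)
        fix z assume z: "z \<in> support x"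
        note mv = sector_finite_configs[OF move_sector[OF N z]]
        have "\<bar>measure_pmf.expectation (p z) (\<lambda>y. ?u (move x z y))\<bar> \<le>
            measure_pmf.expectation (p z) (\<lambda>y. \<bar>?u (move x z y)\<bar>)" by (rule integral_abs_bound)
        also have "\<dots> \<le> measure_pmf.expectation (p z) (\<lambda>y. B * indicator (- Y) (move x z y))"
        proof (intro integral_mono integrable_pmf_bounded)
          fix y
          show "\<bar>?u (move x z y)\<bar> \<le> B * indicator (- Y) (move x z y)" by (rule bv[OF mv])
          show "\<bar>\<bar>?u (move x z y)\<bar>\<bar> \<le> B" using v[OF mv, of y] B by (simp add: indicator_def)
          show "\<bar>B * indicator (- Y) (move x z y)\<bar> \<le> B" using B by (simp add: indicator_def)
        qed
        finally show "\<bar>g (x z) * measure_pmf.expectation (p z) (\<lambda>y. ?u (move x z y))\<bar> \<le>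
            g (x z) * (B * measure_pmf.expectation (p z) (\<lambda>y. indicator (- Y) (move x z y)))"
          unfolding abs_mult abs_of_nonneg[OF g_nonneg] by (intro mult_left_mono g_nonneg) simp
      qed
      also have "\<dots> = B * gen (indicator (- Y)) x"
        using Y by (subst g0) (auto simp: sum_distrib_left mult_ac)
      finally show ?thesis .
    qed
    also have "\<dots> \<le> B * e'" using r B by (intro mult_left_mono) auto
    finally have t2: "h * \<bar>gen (\<lambda>y. v y * indicator (- Y) y) x\<bar> \<le> h * (B * e')"
      using h by (intro mult_left_mono) auto
    have t3: "h * \<bar>\<Sum>y\<in>Y. v y * D h y\<bar> \<le> h * (B * e')"
      using sumD[OF v] h by (intro mult_left_mono) auto
    have "\<bar>?E v - v x - h * gen v x\<bar> \<le> h * \<bar>\<Sum>y\<in>Y. v y * D h y\<bar> +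
        \<bar>?E (\<lambda>y. v y * indicator (- Y) y)\<bar> + h * \<bar>gen (\<lambda>y. v y * indicator (- Y) y) x\<bar>"
    proof -
      have eq: "h * \<bar>r\<bar> = \<bar>h * r\<bar>" for r using h by (simp add: abs_mult)
      show ?thesis using decomp[of v B, OF v] unfolding eq by linarith
    qed
    also have "\<dots> \<le> (4 * B * e') * h" using t1 t2 t3 by (simp add: algebra_simps)
    also have "\<dots> \<le> e * h" using e' h by (intro mult_right_mono) auto
    finally show ?thesis .
  qed
  thus ?thesis using \<delta>(1) by blast
qed

lemma expectation_K_bound:
  fixes F :: "'d config \<Rightarrow> real"
  assumes "x \<in> finite_configs" "0 \<le> t" "\<And>y. y \<in> finite_configs \<Longrightarrow> \<bar>F y\<bar> \<le> B"
  shows "\<bar>measure_pmf.expectation (K t x) F\<bar> \<le> B"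
  using K_set[OF assms(1,2)] assms(3) by (intro abs_expectation_pmf_le) blast

text \<open>The short time \<open>h\<close> is run first, from the fixed state \<open>x\<close>;
  this order leads to the backward equation.\<close>

lemma expectation_K_add:
  fixes F :: "'d config \<Rightarrow> real"
  assumes x: "x \<in> finite_configs" and s: "0 \<le> s" and h: "0 \<le> h"
    and F: "\<And>y. y \<in> finite_configs \<Longrightarrow> \<bar>F y\<bar> \<le> B"
  shows "measure_pmf.expectation (K (s + h) x) F =
    measure_pmf.expectation (K h x) (\<lambda>y. measure_pmf.expectation (K s y) F)"
proof -
  have "K (s + h) x = bind_pmf (K h x) (K s)"
    using K_add[OF x h s] by (simp add: add.commute)
  thus ?thesis
    using K_set[OF x h] K_set[OF _ s] by (auto intro!: expectation_bind_pmf[where B = B] F)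
qed

text \<open>The functions \<open>v s\<close> share the bound \<open>B\<close>, so the derivative at
  0 can be applied to them uniformly in \<open>s\<close>. This uniformity upgrades a right
  derivative to a two-sided one, and uniqueness for the backward equation concludes.\<close>

lemma expectation_K_eq_heat:
  fixes F :: "'d config \<Rightarrow> real"
  assumes x: "x \<in> finite_configs" and t: "0 \<le> t"
    and F: "\<And>y. y \<in> finite_configs \<Longrightarrow> \<bar>F y\<bar> \<le> B"
  shows "measure_pmf.expectation (K t x) F = heat l t F x"
proof -
  have B: "0 \<le> B" using F[OF x] by linarith
  define v where "v s y = measure_pmf.expectation (K s y) F" for s y
  have v: "\<bar>v s y\<bar> \<le> B" if "y \<in> finite_configs" "0 \<le> s" for s y
    unfolding v_def using that F by (intro expectation_K_bound)
  \<comment> \<open>The essential point is that \<open>\<delta>\<close> is chosen before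
    \<open>s\<close>.\<close>
  have incr: "\<exists>\<delta>>0. \<forall>h s. 0 \<le> h \<longrightarrow> h < \<delta> \<longrightarrow> 0 \<le> s \<longrightarrow> \<bar>v (s + h) y - v s y - h * gen (v s) y\<bar> \<le> e * h"
    if y: "y \<in> finite_configs" and e: "0 < e" for y e
  proof -
    obtain \<delta> where \<delta>: "0 < \<delta>" "\<And>h v. 0 < h \<Longrightarrow> h < \<delta> \<Longrightarrow> (\<forall>y\<in>finite_configs. \<bar>v y\<bar> \<le> B) \<Longrightarrow>
        \<bar>measure_pmf.expectation (K h y) v - v y - h * gen v y\<bar> \<le> e * h"
      using K_deriv_uniform[OF y B e] by blast
    have "\<bar>v (s + h) y - v s y - h * gen (v s) y\<bar> \<le> e * h" if "0 \<le> h" "h < \<delta>" "0 \<le> s" for h s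
    proof (cases "h = 0")
      case False
      have "v (s + h) y = measure_pmf.expectation (K h y) (v s)"
        unfolding v_def[abs_def] using that by (intro expectation_K_add[OF y _ _ F])
      thus ?thesis using \<delta>(2)[of h "v s"] v that False by simp
    qed simp
    thus ?thesis using \<delta>(1) by blast
  qed
  have cont: "continuous_on {0..} (\<lambda>s. v s y)" if y: "y \<in> finite_configs" for y
  proof -
    obtain N where N: "y \<in> sector N" using y by (auto simp: finite_configs_eq_sector)
    obtain \<delta> where \<delta>: "0 < \<delta>" "\<And>h s. 0 \<le> h \<Longrightarrow> h < \<delta> \<Longrightarrow> 0 \<le> s \<Longrightarrow>
        \<bar>v (s + h) y - v s y - h * gen (v s) y\<bar> \<le> 1 * h"
      using incr[OF y, of 1] by auto
    define C where "C = 1 + 2 * a0 * N * B"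
    have C: "0 < C" using a0_nonneg B by (simp add: C_def add_pos_nonneg)
    have lip: "\<bar>v (s + h) y - v s y\<bar> \<le> C * h" if "0 \<le> h" "h < \<delta>" "0 \<le> s" for h s
    proof -
      have "\<bar>gen (v s) y\<bar> \<le> 2 * a0 * N * B"
        using v sector_finite_configs that by (intro gen_bound[OF N]) auto
      hence "\<bar>h * gen (v s) y\<bar> \<le> h * (2 * a0 * N * B)"
        unfolding abs_mult using that by (intro mult_mono) auto
      thus ?thesis using \<delta>(2)[OF that] by (simp add: C_def algebra_simps)
    qed
    have lip': "\<bar>v r y - v s y\<bar> \<le> C * \<bar>r - s\<bar>" if "\<bar>r - s\<bar> < \<delta>" "0 \<le> s" "0 \<le> r" for r s
    proof (cases "s \<le> r")
      case True
      thus ?thesis using lip[of "r - s" s] that by simp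
    next
      case False
      thus ?thesis using lip[of "s - r" r] that by (simp add: abs_minus_commute)
    qed
    show ?thesis
      unfolding continuous_on_iff dist_real_def
    proof (intro ballI allI impI)
      fix s e :: real assume s: "s \<in> {0..}" and e: "0 < e"
      have "\<bar>v r y - v s y\<bar> < e" if "r \<in> {0..}" "\<bar>r - s\<bar> < min \<delta> (e / C)" for r
      proof -
        have "\<bar>v r y - v s y\<bar> \<le> C * \<bar>r - s\<bar>" using that s by (intro lip') auto
        also have "\<dots> < e" using that C by (simp add: field_simps)
        finally show ?thesis .
      qed
      thus "\<exists>d>0. \<forall>r\<in>{0..}. \<bar>r - s\<bar> < d \<longrightarrow> \<bar>v r y - v s y\<bar> < e"
        using \<delta>(1) e C by (intro exI[of _ "min \<delta> (e / C)"]) auto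
    qed
  qed
  have gcont: "continuous_on {0..} (\<lambda>s. gen (v s) y)" if y: "y \<in> finite_configs" for y
    unfolding continuous_on_sequentially o_def
  proof (intro ballI allI impI)
    fix s :: real and u :: "nat \<Rightarrow> real"
    assume s: "s \<in> {0..}" and u: "(\<forall>n. u n \<in> {0..}) \<and> u \<longlonglongrightarrow> s"
    obtain N where N: "y \<in> sector N" using y by (auto simp: finite_configs_eq_sector)
    show "(\<lambda>n. gen (v (u n)) y) \<longlonglongrightarrow> gen (v s) y"
    proof (rule gen_tendsto[OF N])
      fix n and z :: "'d config" assume "z \<in> sector N"
      hence z: "z \<in> finite_configs" by (rule sector_finite_configs)
      show "\<bar>v (u n) z\<bar> \<le> B" using u by (intro v z) auto
      show "(\<lambda>n. v (u n) z) \<longlonglongrightarrow> v s z"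
        using cont[OF z] s u unfolding continuous_on_sequentially o_def by blast
    qed
  qed
  have deriv: "((\<lambda>s. v s y) has_real_derivative gen (v s) y) (at s)"
    if y: "y \<in> finite_configs" and s: "0 < s" for s y
    unfolding has_field_derivative_iff
  proof (rule LIM_I)
    fix e :: real assume e: "0 < e"
    obtain \<delta> where \<delta>: "0 < \<delta>" "\<And>h s. 0 \<le> h \<Longrightarrow> h < \<delta> \<Longrightarrow> 0 \<le> s \<Longrightarrow>
        \<bar>v (s + h) y - v s y - h * gen (v s) y\<bar> \<le> e / 4 * h"
      using incr[OF y, of "e / 4"] e by auto
    obtain d where d: "0 < d" "\<And>r. 0 \<le> r \<Longrightarrow> \<bar>r - s\<bar> < d \<Longrightarrow> \<bar>gen (v r) y - gen (v s) y\<bar> < e / 4"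
      using gcont[OF y] s e unfolding continuous_on_iff dist_real_def
      by (metis atLeast_iff less_imp_le zero_less_divide_iff zero_less_numeral)
    have "norm ((v (s + k) y - v s y) / k - gen (v s) y) < e"
      if k: "k \<noteq> 0" "\<bar>k\<bar> < min s (min \<delta> d)" for k
    proof -
      have "\<bar>v (s + k) y - v s y - k * gen (v s) y\<bar> \<le> e / 2 * \<bar>k\<bar>"
      proof (cases "0 \<le> k")
        case True
        have "\<bar>v (s + k) y - v s y - k * gen (v s) y\<bar> \<le> e / 4 * k"
          using True k s by (intro \<delta>(2)) auto
        also have "\<dots> \<le> e / 2 * \<bar>k\<bar>" using True e by (intro mult_mono) auto
        finally show ?thesis .
      next
        case False
        \<comment> \<open>An increment to the left is an increment to the right started at
          \<open>?r\<close>, for which the same \<open>\<delta>\<close> works; continuity of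
          \<open>gen (v _) y\<close> then moves the slope from \<open>?r\<close> to
          \<open>s\<close>. These two errors explain the quarters of \<open>e\<close>.\<close>
        let ?r = "s + k" and ?h = "- k"
        have "\<bar>v (?r + ?h) y - v ?r y - ?h * gen (v ?r) y\<bar> \<le> e / 4 * ?h"
          using False k by (intro \<delta>(2)) auto
        moreover have "\<bar>?h * (gen (v ?r) y - gen (v s) y)\<bar> \<le> ?h * (e / 4)"
          unfolding abs_mult using False k d(2)[of ?r] by (intro mult_mono) auto
        moreover have "v (s + k) y - v s y - k * gen (v s) y =
            - (v (?r + ?h) y - v ?r y - ?h * gen (v ?r) y) - ?h * (gen (v ?r) y - gen (v s) y)"
          by (simp add: algebra_simps)
        ultimately have "\<bar>v (s + k) y - v s y - k * gen (v s) y\<bar> \<le> e / 4 * ?h + ?h * (e / 4)"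
          by linarith
        thus ?thesis using False by (simp add: field_simps)
      qed
      moreover have "(v (s + k) y - v s y) / k - gen (v s) y = (v (s + k) y - v s y - k * gen (v s) y) / k"
        using k by (simp add: field_simps)
      ultimately have "norm ((v (s + k) y - v s y) / k - gen (v s) y) \<le> e / 2"
        using k by (simp add: abs_divide pos_divide_le_eq)
      thus ?thesis using e by linarith
    qed
    note * = this
    have "norm ((v r y - v s y) / (r - s) - gen (v s) y) < e"
      if "r \<noteq> s" "norm (r - s) < min s (min \<delta> d)" for r
      using *[of "r - s"] that by simp
    note * = this
    show "\<exists>d>0. \<forall>r. r \<noteq> s \<and> norm (r - s) < d \<longrightarrow> norm ((v r y - v s y) / (r - s) - gen (v s) y) < e"
      using * s \<delta>(1) d(1) by (intro exI[of _ "min s (min \<delta> d)"]) auto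
  qed
  obtain N where N: "x \<in> sector N" using x by (auto simp: finite_configs_eq_sector)
  have "v t x = heat l t F x"
  proof (rule backward_equation_unique[where v = v and B = B and T = t, OF _ _ _ _ _ _ N t order_refl])
    show "continuous_on {0..t} (\<lambda>s. v s y)" if "y \<in> sector N" for y
      using cont[OF sector_finite_configs[OF that]] by (rule continuous_on_subset) auto
    show "sector_bounded F" using F by (rule sector_bounded_bounded)
    show "sector_bounded (v s)" if "0 \<le> s" for s
      using v[OF _ that] by (rule sector_bounded_bounded)
    show "v 0 y = F y" if "y \<in> sector N" for y
      using K_0[OF sector_finite_configs[OF that]] by (simp add: v_def)
  qed (auto intro: v deriv sector_finite_configs)
  thus ?thesis by (simp add: v_def)
qed

lemma heat_const:
  assumes "x \<in> sector N" "0 \<le> t"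
  shows "heat l t (\<lambda>_. c) x = c"
  by (rule backward_equation_unique[where v = "\<lambda>_ _. c" and B = "\<bar>c\<bar>", symmetric, OF _ _ _ _ _ _ assms order_refl])
    (auto simp: gen_def intro!: sector_bounded_bounded)

lemma K_sector:
  assumes x: "x \<in> sector N" and t: "0 \<le> t"
  shows "set_pmf (K t x) \<subseteq> sector N"
proof -
  have "measure_pmf.prob (K t x) (sector N) = measure_pmf.expectation (K t x) (indicator (sector N))"
    by simp
  also have "\<dots> = heat 0 t (indicator (sector N)) x"
    by (rule expectation_K_eq_heat[where B = 1, OF sector_finite_configs[OF x] t]) (simp add: indicator_def)
  \<comment> \<open>On the sector itself the indicator is 1, and nothing else is seen by
    \<open>heat\<close>.\<close>
  also have "\<dots> = heat 0 t (\<lambda>_. 1) x" by (rule heat_cong[OF _ x]) simp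
  also have "\<dots> = 1" by (rule heat_const[OF x t])
  finally have "AE y in measure_pmf (K t x). y \<in> sector N"
    by (subst measure_pmf.prob_eq_1[symmetric]) simp_all
  thus ?thesis by (auto simp: AE_measure_pmf_iff)
qed

text \<open>Cutting \<open>f\<close> off outside the starting sector changes neither side and makes
  it bounded on all finite configurations.\<close>

lemma expectation_K_eq_heat_sector_bounded:
  assumes f: "sector_bounded f" and x: "x \<in> finite_configs" and t: "0 \<le> t"
  shows "integrable (measure_pmf (K t x)) f" "measure_pmf.expectation (K t x) f = heat l t f x"
proof -
  obtain N where N: "x \<in> sector N" using x by (auto simp: finite_configs_eq_sector)
  note KN = K_sector[OF N t]
  obtain B where B: "0 \<le> B" "\<And>y. y \<in> sector N \<Longrightarrow> \<bar>f y\<bar> \<le> B" using sector_boundedE[OF f] by blast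
  show "integrable (measure_pmf (K t x)) f"
    using KN B by (intro integrable_pmf_bounded) blast
  have "measure_pmf.expectation (K t x) f = measure_pmf.expectation (K t x) (\<lambda>y. f y * indicator (sector N) y)"
    using KN by (intro integral_cong_AE) (auto simp: AE_measure_pmf_iff)
  also have "\<dots> = heat l t (\<lambda>y. f y * indicator (sector N) y) x"
    using B by (intro expectation_K_eq_heat[where B = B] x t) (simp add: indicator_def)
  also have "\<dots> = heat l t f x" by (rule heat_cong[OF _ N]) simp
  finally show "measure_pmf.expectation (K t x) f = heat l t f x" .
qed

end

section \<open>The zero-range Markov chain\<close>

text \<open>The distribution of \<open>Y\<close> as a pmf, so that Chapman-Kolmogorov becomes an
  equation with \<open>bind_pmf\<close>; the choice is justified by
  \<open>distr_pmf\<close>.\<close>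

definition law :: "'s set \<Rightarrow> 'w measure \<Rightarrow> ('w \<Rightarrow> 's) \<Rightarrow> 's pmf" where
  "law S M Y = (SOME K. measure_pmf K = distr M (count_space UNIV) Y \<and> set_pmf K \<subseteq> S)"

lemma law:
  assumes "prob_space M" "Y \<in> measurable M (count_space S)" "countable S"
  shows "measure_pmf (law S M Y) = distr M (count_space UNIV) Y" "set_pmf (law S M Y) \<subseteq> S"
    and "pmf (law S M Y) y = measure M {\<omega> \<in> space M. Y \<omega> = y}"
proof -
  have "\<exists>K. measure_pmf K = distr M (count_space UNIV) Y \<and> set_pmf K \<subseteq> S"
    using distr_pmf[OF assms] by metis
  from someI_ex[OF this] show *: "measure_pmf (law S M Y) = distr M (count_space UNIV) Y" "set_pmf (law S M Y) \<subseteq> S"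
    by (simp_all add: law_def)
  have "Y \<in> measurable M (count_space UNIV)"
    using measurable_compose[OF assms(2), of "\<lambda>x. x" "count_space UNIV"] by simp
  hence "pmf (law S M Y) y = measure M (Y -` {y} \<inter> space M)"
    by (simp add: pmf.rep_eq * measure_distr)
  also have "Y -` {y} \<inter> space M = {\<omega> \<in> space M. Y \<omega> = y}" by auto
  finally show "pmf (law S M Y) y = measure M {\<omega> \<in> space M. Y \<omega> = y}" .
qed

lemma pmf_bind_Pair: "pmf (bind_pmf M (\<lambda>y. map_pmf (Pair y) (N y))) (y, z) = pmf M y * pmf (N y) z"
proof -
  have "pmf (map_pmf (Pair y') (N y')) (y, z) = indicator {y} y' * pmf (N y) z" for y'
  proof (cases "y' = y")
    case True
    thus ?thesis by (simp add: pmf_map_inj' inj_def)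
  next
    case False
    thus ?thesis by (subst pmf_map_outside) auto
  qed
  hence "pmf (bind_pmf M (\<lambda>y. map_pmf (Pair y) (N y))) (y, z) =
      measure_pmf.expectation M (\<lambda>y'. indicator {y} y' * pmf (N y) z)"
    by (simp add: pmf_bind)
  thus ?thesis by (simp add: measure_pmf_single)
qed

text \<open>The Markov property determines the joint law of \<open>X s\<close> and \<open>X (s + t)\<close>.\<close>

lemma law_Chapman_Kolmogorov:
  assumes mc: "markov_chain S Pr X" and x: "x \<in> S" and s: "0 \<le> s" and t: "0 \<le> t"
  shows "law S (Pr x) (X (s + t)) = bind_pmf (law S (Pr x) (X s)) (\<lambda>y. law S (Pr y) (X t))"
proof -
  have S: "countable S" and prob: "prob_space (Pr y)" and meas: "X u \<in> measurable (Pr y) (count_space S)"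
    if "y \<in> S" "0 \<le> u" for y u
    using mc that by (auto simp: markov_chain_def)
  have mk: "measure (Pr x) {\<omega> \<in> A. X s \<omega> = y \<and> X (s + t) \<omega> = z} =
      measure (Pr x) {\<omega> \<in> A. X s \<omega> = y} * trans_prob Pr X t y z"
    if "A \<in> history S (Pr x) X s" "y \<in> S" "z \<in> S" for A y z
    using mc x s t that by (auto simp: markov_chain_def)
  note S = S[OF x s] and px = prob[OF x s]
  have st: "0 \<le> s + t" using s t by simp
  let ?Y = "\<lambda>\<omega>. (X s \<omega>, X (s + t) \<omega>)"
  have Y: "?Y \<in> measurable (Pr x) (count_space (S \<times> S))"
    using measurable_Pair[OF meas[OF x s] meas[OF x st]] by (simp add: pair_measure_countable S)
  define J where "J = law (S \<times> S) (Pr x) ?Y"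
  note J = law[OF px Y countable_SIGMA[OF S S], folded J_def]
  have "J = bind_pmf (law S (Pr x) (X s)) (\<lambda>y. map_pmf (Pair y) (law S (Pr y) (X t)))"
  proof (rule pmf_eqI)
    fix w :: "'a \<times> 'a" obtain y z where w: "w = (y, z)" by (cases w)
    show "pmf J w = pmf (bind_pmf (law S (Pr x) (X s)) (\<lambda>y. map_pmf (Pair y) (law S (Pr y) (X t)))) w"
      unfolding w pmf_bind_Pair
    proof (cases "y \<in> S \<and> z \<in> S")
      case True
      \<comment> \<open>Applied to the certain event, the Markov property gives the joint point
        masses.\<close>
      have "space (Pr x) \<in> history S (Pr x) X s" unfolding history_def by (rule sigma_sets_top)
      from mk[OF this, of y z] True
      show "pmf J (y, z) = pmf (law S (Pr x) (X s)) y * pmf (law S (Pr y) (X t)) z"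
        by (simp add: J(3) law(3)[OF px meas[OF x s] S] law(3)[OF prob[OF _ t] meas[OF _ t] S] trans_prob_def)
    next
      case False
      have "pmf J (y, z) = 0" using J(2) False by (auto simp: pmf_eq_0_set_pmf)
      moreover have "pmf (law S (Pr x) (X s)) y = 0" if "y \<notin> S"
        using law(2)[OF px meas[OF x s] S] that by (auto simp: pmf_eq_0_set_pmf)
      moreover have "pmf (law S (Pr y) (X t)) z = 0" if "y \<in> S" "z \<notin> S"
        using law(2)[OF prob[OF that(1) t] meas[OF that(1) t] S] that by (auto simp: pmf_eq_0_set_pmf)
      ultimately show "pmf J (y, z) = pmf (law S (Pr x) (X s)) y * pmf (law S (Pr y) (X t)) z"
        using False by auto
    qed
  qed
  \<comment> \<open>Chapman-Kolmogorov is the second marginal of the joint law.\<close>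
  hence "map_pmf snd J = bind_pmf (law S (Pr x) (X s)) (\<lambda>y. law S (Pr y) (X t))"
    by (simp add: map_bind_pmf map_pmf_comp)
  moreover have "map_pmf snd J = law S (Pr x) (X (s + t))"
  proof -
    have Y': "?Y \<in> measurable (Pr x) (count_space UNIV)"
      using measurable_compose[OF Y, of "\<lambda>x. x" "count_space UNIV"] by simp
    have "measure_pmf (map_pmf snd J) = measure_pmf (law S (Pr x) (X (s + t)))"
      using Y' by (simp add: map_pmf_rep_eq J(1) law(1)[OF px meas[OF x st] S] distr_distr o_def)
    thus ?thesis by (simp add: measure_pmf_inject)
  qed
  ultimately show ?thesis by simp
qed

text \<open>The one-time laws of any such chain satisfy \<open>generated_semigroup\<close>, so
  expectations are forced to equal \<open>heat\<close>, whatever the probability space.\<close>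

lemma (in zero_range) zero_range_chain_expectation:
  assumes zr: "zero_range_chain p g Pr X"
    and f: "f \<in> Lip p" and \<eta>: "\<eta> \<in> finite_configs" and t: "0 \<le> t"
  shows "has_bochner_integral (Pr \<eta>) (\<lambda>\<omega>. f (X t \<omega>)) (semigroup t f \<eta>)"
proof -
  let ?S = "finite_configs :: 'd config set"
  have mc: "markov_chain ?S Pr X" and gen: "has_generator ?S Pr X (zr_gen p g)"
    using zr by (auto simp: zero_range_chain_def)
  have S: "countable ?S" using mc by (simp add: markov_chain_def)
  have prob: "prob_space (Pr y)" if "y \<in> ?S" for y
    using mc that by (auto simp: markov_chain_def)
  have meas: "X u \<in> measurable (Pr y) (count_space ?S)" if "y \<in> ?S" "0 \<le> u" for y u
    using mc that by (auto simp: markov_chain_def)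
  have init: "AE \<omega> in Pr y. X 0 \<omega> = y" if "y \<in> ?S" for y
    using mc that by (auto simp: markov_chain_def)
  define K where "K u y = law ?S (Pr y) (X u)" for u y
  note K = law[OF prob meas S, folded K_def]
  have meas': "X u \<in> measurable (Pr y) (count_space UNIV)" if "y \<in> ?S" "0 \<le> u" for y u
    using measurable_compose[OF meas[OF that], of "\<lambda>x. x" "count_space UNIV"] by simp
  interpret generated_semigroup p g a0 K
  proof
    show "countable ?S" by (rule S)
    fix x assume x: "x \<in> ?S"
    have "AE y in measure_pmf (K 0 x). y = x"
      unfolding K(1)[OF x x order_refl] using init[OF x] by (subst AE_distr_iff[OF meas'[OF x]]) auto
    thus "K 0 x = return_pmf x"
      by (auto simp: AE_measure_pmf_iff simp flip: set_pmf_subset_singleton)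
    show "set_pmf (K t x) \<subseteq> ?S" if "0 \<le> t" for t by (rule K(2)[OF x x that])
    show "K (s + t) x = bind_pmf (K s x) (K t)" if "0 \<le> s" "0 \<le> t" for s t
      unfolding K_def[abs_def] by (rule law_Chapman_Kolmogorov[OF mc x that])
    fix y assume y: "y \<in> ?S"
    obtain N where N: "x \<in> sector N" using x by (auto simp: finite_configs_eq_sector)
    have eq: "zr_gen p g (indicator {y}) x = gen (indicator {y}) x"
      by (rule zr_gen_finite[OF _ N]) (rule sector_boundedI[where B = "\<lambda>_. 1"], simp add: indicator_def)
    have "((\<lambda>t. trans_prob Pr X t x y) has_real_derivative gen (indicator {y}) x) (at 0 within {0..})"
      using gen x y unfolding has_generator_def eq[symmetric] by blast
    \<comment> \<open>\<open>trans_prob\<close> and the mass of \<open>K t x\<close> are identified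
      only for nonnegative times, which suffices for the one-sided derivative.\<close>
    from has_field_derivative_transform_within[OF this zero_less_one, of "\<lambda>t. pmf (K t x) y"]
    show "((\<lambda>t. pmf (K t x) y) has_real_derivative gen (indicator {y}) x) (at 0 within {0..})"
      by (simp add: trans_prob_def K(3)[OF x x])
  qed
  note E = expectation_K_eq_heat_sector_bounded[OF Lip_sector_bounded[OF f] \<eta> t]
  have "integrable (Pr \<eta>) (\<lambda>\<omega>. f (X t \<omega>))"
    using E(1) by (simp add: K(1)[OF \<eta> \<eta> t] integrable_distr_eq[OF meas'[OF \<eta> t]])
  moreover have "(\<integral>\<omega>. f (X t \<omega>) \<partial>Pr \<eta>) = semigroup t f \<eta>"
    using E(2)[of 0] by (simp add: K(1)[OF \<eta> \<eta> t] integral_distr[OF meas'[OF \<eta> t]] semigroup_finite[OF \<eta>])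
  ultimately show ?thesis by (simp add: has_bochner_integral_iff)
qed

theorem theorem7p2p3:
  fixes p :: "'d::finite site \<Rightarrow> 'd site pmf"
    and g :: "nat \<Rightarrow> real"
    and a0 :: real
  assumes g_0: "g 0 = 0"
    and g_pos: "\<And>k. k \<ge> 1 \<Longrightarrow> g k > 0"
    and g_lip: "\<And>k. \<bar>g (k + 1) - g k\<bar> \<le> a0"
    and p_irreducible: "irreducible_kernel p"
    and p_vanish: "\<And>y. ((\<lambda>x. pmf (p x) y) \<longlongrightarrow> 0) cofinite"
  shows "\<exists>P :: real \<Rightarrow> ('d config \<Rightarrow> real) \<Rightarrow> ('d config \<Rightarrow> real).
    semigroup_on_Lip p P \<and>
    (\<forall>(Pr :: 'd config \<Rightarrow> 'w measure) X. zero_range_chain p g Pr X \<longrightarrow>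
       (\<forall>f\<in>Lip p. \<forall>\<eta>\<in>finite_configs. \<forall>t\<ge>0.
          has_bochner_integral (Pr \<eta>) (\<lambda>\<omega>. f (X t \<omega>)) (P t f \<eta>))) \<and>
    (\<forall>f\<in>Lip p. \<forall>t\<ge>0.
       (\<forall>\<eta>\<in>Omega' p. \<forall>\<zeta>\<in>Omega' p.
          \<bar>P t f \<eta> - P t f \<zeta>\<bar> \<le> lip_const p f * exp (4 * a0 * t) * cdist p \<eta> \<zeta>) \<and>
       lip_const p (P t f) \<le> lip_const p f * exp (4 * a0 * t) \<and>
       (\<forall>\<eta>\<in>Omega' p.
          set_integrable lborel {0..t} (\<lambda>s. zr_gen p g (P s f) \<eta>) \<and>
          P t f \<eta> = f \<eta> + (LINT s:{0..t}|lborel. zr_gen p g (P s f) \<eta>)))"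
proof -
  have g_nonneg: "0 \<le> g k" for k
    using g_0 g_pos[of k] by (cases "k = 0") auto
  interpret zero_range p g a0
    by unfold_locales (fact g_0 g_nonneg g_lip)+
  have lip: "lipschitz_bound p (semigroup t f) (lip_const p f * exp (4 * a0 * t))"
    if f: "f \<in> Lip p" and t: "0 \<le> t" for f t
    unfolding lipschitz_bound_def
  proof (intro ballI)
    fix \<eta> \<zeta> :: "'d config" assume "\<eta> \<in> Omega' p" "\<zeta> \<in> Omega' p"
    hence "\<bar>semigroup t f \<eta> - semigroup t f \<zeta>\<bar> \<le> lip_const p f * exp (3 * a0 * t) * cdist p \<eta> \<zeta>"
      by (intro lipschitz_boundD[OF semigroup_lipschitz[OF lip_const(1)[OF f] t]])
    \<comment> \<open>The construction yields the rate \<open>3 * a0\<close>; as the Lipschitz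
      constant and \<open>a0 * t\<close> are nonnegative, it may be enlarged to
      \<open>4 * a0\<close>.\<close>
    also have "\<dots> \<le> lip_const p f * exp (4 * a0 * t) * cdist p \<eta> \<zeta>"
      using a0_nonneg t lipschitz_bound_nonneg[OF lip_const(1)[OF f]]
      by (intro mult_right_mono mult_left_mono cdist_nonneg) (simp_all add: mult_right_mono)
    finally show "\<bar>semigroup t f \<eta> - semigroup t f \<zeta>\<bar> \<le> lip_const p f * exp (4 * a0 * t) * cdist p \<eta> \<zeta>" .
  qed
  have "semigroup_on_Lip p semigroup"
    unfolding semigroup_on_Lip_def
    by (auto simp: semigroup_Lip semigroup_lin semigroup_0 semigroup_add)
  moreover have "lip_const p (semigroup t f) \<le> lip_const p f * exp (4 * a0 * t)"
    if "f \<in> Lip p" "0 \<le> t" for f t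
    using lip_const(2)[OF semigroup_Lip lip] that by blast
  moreover have "\<bar>semigroup t f \<eta> - semigroup t f \<zeta>\<bar> \<le> lip_const p f * exp (4 * a0 * t) * cdist p \<eta> \<zeta>"
    if "f \<in> Lip p" "0 \<le> t" "\<eta> \<in> Omega' p" "\<zeta> \<in> Omega' p" for f t \<eta> \<zeta>
    using lipschitz_boundD[OF lip] that by blast
  ultimately show ?thesis
    by (intro exI[of _ semigroup] conjI allI impI ballI zero_range_chain_expectation semigroup_integral)
qed

end
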